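(* Consider a stagewise independent multistage stochastic program with the regularization, standing assumptions and deterministic sampling dual dynamic programming algorithm described in the context. For $0\le t\le T-1$ let $D_t$ be the diameter of the smallest ball (in the norm $\|\cdot\|$) containing $\mathcal X_t$, and let $L,d,D$ be upper bounds for $L_t$, $d_t$ and $D_t$ respectively, $0\le t\le T-1$. Let $\epsilon>0$. If the algorithm (run with tolerance $T\epsilon$) terminates with a $(T\epsilon)$-optimal root node solution $(x_0^*,y_0^* )$, then the iteration index $i$ at termination satisfies $$i\le T\left(1+\frac{2LD}{\epsilon}\right)^d.$$
   Context: **Problem.** $T\ge1$. For each stage $t=1,\dots,T$ there is a finite set $\tilde{\mathcal N}(t)$ of distinct nodes; $\tilde{\mathcal N}(0)=\{r\}$. Node $m\in\tilde{\mathcal N}(t)$, $t\ge1$, is realized with probability $p_{t-1,m}>0$ independently of the past, $\sum_{m\in\tilde{\mathcal N}(t)}p_{t-1,m}=1$. Each node $m\in\tilde{\mathcal N}(t)$ has a compact set $\mathcal F_m$ of pairs $(x,y)$ in a Euclidean space, and for $t\le T-1$ its projection onto the $x$-coordinates is the same set $\mathcal X_t\subset\mathbb R^{d_t}$ for all $m\in\tilde{\mathcal N}(t)$; $\mathcal X_{-1}=\{0\}$ and $x_{-1}=0$. The cost $f_m(z,y,x)\in[0,+\infty]$, defined for $z\in\mathcal X_{t-1}$, $(x,y)\in\mathcal F_m$, is lower semicontinuous. The scenario tree has as stage-$t$ nodes the sequences $n=(n_1,\dots,n_t)$, $n_s\in\tilde{\mathcal N}(s)$ (the root being the empty sequence),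 with the data of $n_t$, probability $p_n=\prod_{s\le t}p_{s-1,n_s}$ and parent $a(n)=(n_1,\dots,n_{t-1})$; the original problem is to minimize $\sum_n p_nf_n(x_{a(n)},y_n,x_n)$ over $(x_n,y_n)\in\mathcal F_n$ for all tree nodes $n$, and it is assumed to have a feasible solution with finite objective. Fix a norm $\|\cdot\|$ with dual norm $\|\cdot\|_*$. **Regularization.** A penalty function is $\psi:\mathbb R^d\to\mathbb R_+$ with $\psi(x)=0$ iff $x=0$ and with the diameter of $\{\psi\le a\}$ tending to $0$ as $a\to0$. For each $m\in\tilde{\mathcal N}(t)$ a penalty function $\psi_m$, 1-Lipschitz on $\mathcal X_{t-1}-\mathcal X_{t-1}$, and $\sigma_m>0$ are given. With $\mathcal Q_T^{\mathrm R}\equiv0$ and $\mathcal Q_t^{\mathrm R}(x)=\sum_{m\in\tilde{\mathcal N}(t+1)}p_{t,m}Q_m^{\mathrm R}(x)$ for $t<T$, define for $m\in\tilde{\mathcal N}(t)$ $$Q_m^{\mathrm R}(x_{t-1})=\min_{(x,y)\in\mathcal F_m,\ z\in\mathcal X_{t-1}}\{f_m(z,y,x)+\sigma_m\psi_m(x_{t-1}-z)+\mathcal Q_t^{\mathrm R}(x)\}.$$ $v^{\mathrm{reg}}=\min_{(x,y)\in\mathcal F_r}\{f_r(0,y,x)+\mathcal Q_0^{\mathrm R}(x)\}$; for $\eta>0$, $(x_0,y_0)\in\mathcal F_r$ is an $\eta$-optimal root node solution if $f_r(0,y_0,x_0)+\mathcal Q_0^{\mathrm R}(x_0)\le v^{\mathrm{reg}}+\eta$.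 Standing assumption (exactness): every optimal solution of the problem of minimizing $\sum_n p_n(f_n(z_n,y_n,x_n)+\sigma_n\psi_n(x_{a(n)}-z_n))$ over $(x_n,y_n)\in\mathcal F_n$, $z_n\in\mathcal X_{t(n)-1}$ for all scenario tree nodes $n$ (where $t(n)$ is the stage of $n$) satisfies $z_n=x_{a(n)}$ for all $n$. The problem is called convex if all $\mathcal F_m,f_m,\psi_m$ are convex. For $m\neq r$ let $\mathcal U_m=\{(\lambda,\rho):\|\lambda\|_*\le l_{m,\lambda},\ 0\le\rho\le l_{m,\rho}\}$ with given nonnegative bounds satisfying $l_{m,\lambda}\ge\sigma_m,\ l_{m,\rho}=0$ in the convex case with $\psi_m=\|\cdot\|$, and $l_{m,\rho}\ge\sigma_m$ otherwise. Put $L_t=\sum_{m\in\tilde{\mathcal N}(t+1)}p_{t,m}(l_{m,\lambda}+l_{m,\rho})$ for $0\le t\le T-1$. **Deterministic sampling algorithm with tolerance $\eta>0$.** "An optimal solution" means any optimal solution returned by a given oracle. Initialize $\underline{\mathcal Q}_t^0\equiv0$ for all $t$, $\overline{\mathcal Q}_t^0\equiv+\infty$ for $t\le T-1$, and $\underline{\mathcal Q}_T^i\equiv\overline{\mathcal Q}_T^i\equiv0$ for all $i$. Let $(x_0^1,y_0^1)$ be an optimal solution of $\min_{(x,y)\in\mathcal F_r}f_r(0,y,x)$, $\mathrm{LB}=f_r(0,y_0^1,x_0^1)$, $\mathrm{UB}=+\infty$. For $i=1,2,\dots$, while $\mathrm{UB}-\mathrm{LB}>\eta$, iteration $i$ is: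 (Forward) for $t=1,\dots,T$: for each $n\in\tilde{\mathcal N}(t)$, $(x_n^i,y_n^i,z_n^i)$ is an optimal solution of $\min_{(x,y)\in\mathcal F_n,z\in\mathcal X_{t-1}}\{f_n(z,y,x)+\sigma_n\psi_n(x_{t-1}^i-z)+\underline{\mathcal Q}_t^{i-1}(x)\}$; if $t\le T-1$, let $\gamma_n^i=\overline{\mathcal Q}_t^{i-1}(x_n^i)-\underline{\mathcal Q}_t^{i-1}(x_n^i)$, select any $n^*\in\tilde{\mathcal N}(t)$ with $\gamma_{n^*}^i\ge\gamma_n^i$ for all $n\in\tilde{\mathcal N}(t)$, and set $x_t^i=x_{n^*}^i$. (Backward) for $t=T,\dots,1$: if $t<T$, set $\underline{\mathcal Q}_t^i(x)=\max\{\underline{\mathcal Q}_t^{i-1}(x),\sum_{m\in\tilde{\mathcal N}(t+1)}p_{t,m}C_m^i(x)\}$ and let $\overline{\mathcal Q}_t^i$ be $\mathrm{conv}\{\overline{\mathcal Q}_t^{i-1},h_t^i\}$ in the convex case and $\min\{\overline{\mathcal Q}_t^{i-1},h_t^i\}$ otherwise, where $h_t^i(x)=\sum_{m\in\tilde{\mathcal N}(t+1)}p_{t,m}(\bar v_m^i+\sigma_m\|x-x_t^i\|)$ and $\mathrm{conv}\{f,g\}$ is the convex biconjugate of $\min\{f,g\}$ on $\mathbb R^{d_t}$. Then for each $n\in\tilde{\mathcal N}(t)$ let $\underline v_n^i$ be the optimal value and $(\hat\lambda_n^i,\hat\rho_n^i)$ an optimal outer solution of $\max_{(\lambda,\rho)\in\mathcal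 U_n}\min_{(x,y)\in\mathcal F_n,z\in\mathcal X_{t-1}}\{f_n(z,y,x)+\langle\lambda,x_{t-1}^i-z\rangle+\rho\psi_n(x_{t-1}^i-z)+\underline{\mathcal Q}_t^i(x)\}$; set $C_n^i(x)=-\langle\hat\lambda_n^i,x_{t-1}^i-x\rangle-\hat\rho_n^i\psi_n(x_{t-1}^i-x)+\underline v_n^i$ and $\bar v_n^i=f_n(z_n^i,y_n^i,x_n^i)+\sigma_n\psi_n(x_{t-1}^i-z_n^i)+\overline{\mathcal Q}_t^i(x_n^i)$. (Root) update $\underline{\mathcal Q}_0^i,\overline{\mathcal Q}_0^i$ by the same formulas with $t=0$; let $(x_0^{i+1},y_0^{i+1})$ be an optimal solution of $\min_{(x,y)\in\mathcal F_r}\{f_r(0,y,x)+\underline{\mathcal Q}_0^i(x)\}$; set $\mathrm{LB}=f_r(0,y_0^{i+1},x_0^{i+1})+\underline{\mathcal Q}_0^i(x_0^{i+1})$; if $\mathrm{UB}>f_r(0,y_0^{i+1},x_0^{i+1})+\overline{\mathcal Q}_0^i(x_0^{i+1})$, set $\mathrm{UB}$ to this value and $(x_0^*,y_0^* )=(x_0^{i+1},y_0^{i+1})$. *)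

theory Defs
  imports "HOL-Analysis.Analysis"
begin

text \<open>
  The dimensions \<open>d\<^sub>t\<close> of the state spaces vary with the stage. The space of stage-\<open>t\<close> states is
  therefore a linear subspace, of dimension \<open>d\<^sub>t\<close>, of one Euclidean type \<open>'x\<close>, and norms, dual
  norms, penalties and conjugates are relativised to a subspace \<open>S\<close>. For given \<open>d\<^sub>t\<close> one may take
  coordinate subspaces of a sufficiently large \<open>\<real>\<^sup>n\<close>.
\<close>

definition norm_on :: "'x::real_vector set \<Rightarrow> ('x \<Rightarrow> real) \<Rightarrow> bool" where
  "norm_on S N \<longleftrightarrow>
     (\<forall>x\<in>S. 0 \<le> N x \<and> (N x = 0 \<longleftrightarrow> x = 0)) \<and>
     (\<forall>x\<in>S. \<forall>c. N (c *\<^sub>R x) = \<bar>c\<bar> * N x) \<and>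
     (\<forall>x\<in>S. \<forall>y\<in>S. N (x + y) \<le> N x + N y)"

definition dual_norm_on :: "'x::real_inner set \<Rightarrow> ('x \<Rightarrow> real) \<Rightarrow> 'x \<Rightarrow> real" where
  "dual_norm_on S N l = (SUP x \<in> {x \<in> S. N x \<le> 1}. l \<bullet> x)"

definition ball_diameter_on :: "'x::real_vector set \<Rightarrow> ('x \<Rightarrow> real) \<Rightarrow> 'x set \<Rightarrow> real" where
  "ball_diameter_on S N X = Inf {2 * r | r. 0 \<le> r \<and> (\<exists>c\<in>S. \<forall>x\<in>X. N (x - c) \<le> r)}"

text \<open>
  The boundedness clause is needed because \<^const>\<open>diameter\<close> is unspecified on unbounded sets.
\<close>

definition penalty_on :: "'x::euclidean_space set \<Rightarrow> ('x \<Rightarrow> real) \<Rightarrow> bool" where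
  "penalty_on S \<psi> \<longleftrightarrow>
     (\<forall>x\<in>S. 0 \<le> \<psi> x \<and> (\<psi> x = 0 \<longleftrightarrow> x = 0)) \<and>
     (\<forall>\<^sub>F a in at_right 0. bounded {x \<in> S. \<psi> x \<le> a}) \<and>
     ((\<lambda>a. diameter {x \<in> S. \<psi> x \<le> a}) \<longlongrightarrow> 0) (at_right 0)"

definition lsc_on :: "'a::topological_space set \<Rightarrow> ('a \<Rightarrow> ereal) \<Rightarrow> bool" where
  "lsc_on A g \<longleftrightarrow> (\<forall>a\<in>A. g a \<le> Liminf (at a within A) g)"

definition ereal_convex_on :: "'a::real_vector set \<Rightarrow> ('a \<Rightarrow> ereal) \<Rightarrow> bool" where
  "ereal_convex_on A g \<longleftrightarrow> convex A \<and>
     (\<forall>a\<in>A. \<forall>b\<in>A. \<forall>u\<ge>0. \<forall>v\<ge>0. u + v = 1 \<longrightarrow>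
        g (u *\<^sub>R a + v *\<^sub>R b) \<le> ereal u * g a + ereal v * g b)"

definition conjugate_on :: "'x::real_inner set \<Rightarrow> ('x \<Rightarrow> ereal) \<Rightarrow> 'x \<Rightarrow> ereal" where
  "conjugate_on S g l = (SUP x\<in>S. ereal (l \<bullet> x) - g x)"

definition conv_min_on :: "'x::real_inner set \<Rightarrow> ('x \<Rightarrow> ereal) \<Rightarrow> ('x \<Rightarrow> ereal) \<Rightarrow> 'x \<Rightarrow> ereal" where
  "conv_min_on S g h = conjugate_on S (conjugate_on S (\<lambda>x. min (g x) (h x)))"

text \<open>
  \<open>stnorm P t\<close> is the fixed norm on the state space \<open>stspace P t\<close>; \<open>prob P t m\<close> is \<open>p\<^bsub>t,m\<^esub>\<close>
  for \<open>m \<in> nodes P (t + 1)\<close>; \<open>cost P m z y x\<close> is \<open>f\<^sub>m(z,y,x)\<close>; \<open>lbound\<close> and \<open>rbound\<close> are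
  \<open>l\<^bsub>m,\<lambda>\<^esub>\<close> and \<open>l\<^bsub>m,\<rho>\<^esub>\<close>. The fields \<open>stspace\<close>, \<open>stset\<close> and \<open>stnorm\<close> are
  meaningful for \<open>0 \<le> t \<le> T - 1\<close> only.
\<close>

record ('n, 'x, 'y) msp =
  horizon :: nat
  nodes :: "nat \<Rightarrow> 'n set"
  root_node :: 'n
  prob :: "nat \<Rightarrow> 'n \<Rightarrow> real"
  stspace :: "nat \<Rightarrow> 'x set"
  stset :: "nat \<Rightarrow> 'x set"
  stnorm :: "nat \<Rightarrow> 'x \<Rightarrow> real"
  feas :: "'n \<Rightarrow> ('x \<times> 'y) set"
  cost :: "'n \<Rightarrow> 'x \<Rightarrow> 'y \<Rightarrow> 'x \<Rightarrow> ereal"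
  penalty :: "'n \<Rightarrow> 'x \<Rightarrow> real"
  sigma :: "'n \<Rightarrow> real"
  lbound :: "'n \<Rightarrow> real"
  rbound :: "'n \<Rightarrow> real"

text \<open>\<open>prev_space P t\<close> and \<open>prev_set P t\<close> are \<open>\<real>\<^bsup>d\<^esup>\<close> with \<open>d = d\<^bsub>t-1\<^esub>\<close>, and \<open>X\<^bsub>t-1\<^esub>\<close>.\<close>

definition prev_space :: "('n, 'x::euclidean_space, 'y) msp \<Rightarrow> nat \<Rightarrow> 'x set" where
  "prev_space P t = (if t = 0 then {0} else stspace P (t - 1))"

definition prev_set :: "('n, 'x::euclidean_space, 'y) msp \<Rightarrow> nat \<Rightarrow> 'x set" where
  "prev_set P t = (if t = 0 then {0} else stset P (t - 1))"

definition node_feas ::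
    "('n, 'x::euclidean_space, 'y::euclidean_space) msp \<Rightarrow> nat \<Rightarrow> 'n \<Rightarrow> ('x \<times> 'y \<times> 'x) set" where
  "node_feas P t m = {(x, y, z). (x, y) \<in> feas P m \<and> z \<in> prev_set P t}"

definition stagewise_problem :: "('n, 'x::euclidean_space, 'y::euclidean_space) msp \<Rightarrow> bool" where
  "stagewise_problem P \<longleftrightarrow>
     1 \<le> horizon P \<and>
     nodes P 0 = {root_node P} \<and>
     (\<forall>t\<le>horizon P. finite (nodes P t)) \<and>
     (\<forall>s\<le>horizon P. \<forall>t\<le>horizon P. s \<noteq> t \<longrightarrow> nodes P s \<inter> nodes P t = {}) \<and>
     (\<forall>t<horizon P. (\<forall>m\<in>nodes P (Suc t). 0 < prob P t m) \<and>
        (\<Sum>m\<in>nodes P (Suc t). prob P t m) = 1) \<and>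
     (\<forall>t<horizon P. subspace (stspace P t) \<and> norm_on (stspace P t) (stnorm P t) \<and>
        stset P t \<subseteq> stspace P t \<and> (\<forall>m\<in>nodes P t. fst ` feas P m = stset P t)) \<and>
     (\<forall>t\<le>horizon P. \<forall>m\<in>nodes P t. compact (feas P m) \<and>
        (\<forall>(x, y, z)\<in>node_feas P t m. 0 \<le> cost P m z y x) \<and>
        lsc_on (node_feas P t m) (\<lambda>(x, y, z). cost P m z y x))"

text \<open>The penalty of the root lives on the zero space, so its Lipschitz condition is void.\<close>

definition regularization :: "('n, 'x::euclidean_space, 'y::euclidean_space) msp \<Rightarrow> bool" where
  "regularization P \<longleftrightarrow>
     (\<forall>t\<le>horizon P. \<forall>m\<in>nodes P t. 0 < sigma P m \<and> penalty_on (prev_space P t) (penalty P m)) \<and>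
     (\<forall>t<horizon P. \<forall>m\<in>nodes P (Suc t).
        \<forall>u\<in>{a - b | a b. a \<in> stset P t \<and> b \<in> stset P t}.
        \<forall>v\<in>{a - b | a b. a \<in> stset P t \<and> b \<in> stset P t}.
          \<bar>penalty P m u - penalty P m v\<bar> \<le> stnorm P t (u - v))"

definition convex_problem :: "('n, 'x::euclidean_space, 'y::euclidean_space) msp \<Rightarrow> bool" where
  "convex_problem P \<longleftrightarrow> (\<forall>t\<le>horizon P. \<forall>m\<in>nodes P t.
     convex (feas P m) \<and>
     ereal_convex_on (node_feas P t m) (\<lambda>(x, y, z). cost P m z y x) \<and>
     convex_on (prev_space P t) (penalty P m))"

definition norm_penalties :: "('n, 'x::euclidean_space, 'y::euclidean_space) msp \<Rightarrow> bool" where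
  "norm_penalties P \<longleftrightarrow> (\<forall>t<horizon P. \<forall>m\<in>nodes P (Suc t). \<forall>x\<in>stspace P t.
     penalty P m x = stnorm P t x)"

definition dual_bounds :: "('n, 'x::euclidean_space, 'y::euclidean_space) msp \<Rightarrow> bool" where
  "dual_bounds P \<longleftrightarrow> (\<forall>t<horizon P. \<forall>m\<in>nodes P (Suc t).
     0 \<le> lbound P m \<and> 0 \<le> rbound P m \<and>
     (if convex_problem P \<and> norm_penalties P
      then sigma P m \<le> lbound P m \<and> rbound P m = 0
      else sigma P m \<le> rbound P m))"

definition dual_set :: "('n, 'x::euclidean_space, 'y) msp \<Rightarrow> nat \<Rightarrow> 'n \<Rightarrow> ('x \<times> real) set" where
  "dual_set P t m = {(l, \<rho>). l \<in> stspace P (t - 1) \<and>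
     dual_norm_on (stspace P (t - 1)) (stnorm P (t - 1)) l \<le> lbound P m \<and>
     0 \<le> \<rho> \<and> \<rho> \<le> rbound P m}"

definition lip_const :: "('n, 'x, 'y) msp \<Rightarrow> nat \<Rightarrow> real" where
  "lip_const P t = (\<Sum>m\<in>nodes P (Suc t). prob P t m * (lbound P m + rbound P m))"

definition state_diameter :: "('n, 'x::euclidean_space, 'y) msp \<Rightarrow> nat \<Rightarrow> real" where
  "state_diameter P t = ball_diameter_on (stspace P t) (stnorm P t) (stset P t)"

definition tree_nodes :: "('n, 'x, 'y) msp \<Rightarrow> 'n list set" where
  "tree_nodes P = {ns. length ns \<le> horizon P \<and> (\<forall>s<length ns. ns ! s \<in> nodes P (Suc s))}"

definition tree_data :: "('n, 'x, 'y) msp \<Rightarrow> 'n list \<Rightarrow> 'n" where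
  "tree_data P ns = (if ns = [] then root_node P else last ns)"

definition tree_prob :: "('n, 'x, 'y) msp \<Rightarrow> 'n list \<Rightarrow> real" where
  "tree_prob P ns = (\<Prod>s<length ns. prob P s (ns ! s))"

definition parent_state :: "('n list \<Rightarrow> 'x::zero) \<Rightarrow> 'n list \<Rightarrow> 'x" where
  "parent_state X ns = (if ns = [] then 0 else X (butlast ns))"

definition tree_feasible ::
    "('n, 'x, 'y) msp \<Rightarrow> ('n list \<Rightarrow> 'x) \<Rightarrow> ('n list \<Rightarrow> 'y) \<Rightarrow> bool" where
  "tree_feasible P X Y \<longleftrightarrow> (\<forall>ns\<in>tree_nodes P. (X ns, Y ns) \<in> feas P (tree_data P ns))"

definition tree_cost ::
    "('n, 'x::zero, 'y) msp \<Rightarrow> ('n list \<Rightarrow> 'x) \<Rightarrow> ('n list \<Rightarrow> 'y) \<Rightarrow> ereal" where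
  "tree_cost P X Y = (\<Sum>ns\<in>tree_nodes P.
     ereal (tree_prob P ns) * cost P (tree_data P ns) (parent_state X ns) (Y ns) (X ns))"

definition finite_feasible :: "('n, 'x::zero, 'y) msp \<Rightarrow> bool" where
  "finite_feasible P \<longleftrightarrow> (\<exists>X Y. tree_feasible P X Y \<and> tree_cost P X Y < \<infinity>)"

definition reg_tree_feasible :: "('n, 'x::euclidean_space, 'y) msp \<Rightarrow>
    ('n list \<Rightarrow> 'x) \<times> ('n list \<Rightarrow> 'y) \<times> ('n list \<Rightarrow> 'x) \<Rightarrow> bool" where
  "reg_tree_feasible P = (\<lambda>(X, Y, Z). tree_feasible P X Y \<and>
     (\<forall>ns\<in>tree_nodes P. Z ns \<in> prev_set P (length ns)))"

definition reg_tree_cost :: "('n, 'x::euclidean_space, 'y) msp \<Rightarrow>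
    ('n list \<Rightarrow> 'x) \<times> ('n list \<Rightarrow> 'y) \<times> ('n list \<Rightarrow> 'x) \<Rightarrow> ereal" where
  "reg_tree_cost P = (\<lambda>(X, Y, Z). \<Sum>ns\<in>tree_nodes P. ereal (tree_prob P ns) *
     (cost P (tree_data P ns) (Z ns) (Y ns) (X ns) +
      ereal (sigma P (tree_data P ns) * penalty P (tree_data P ns) (parent_state X ns - Z ns))))"

definition exact_regularization :: "('n, 'x::euclidean_space, 'y) msp \<Rightarrow> bool" where
  "exact_regularization P \<longleftrightarrow> (\<forall>X Y Z.
     is_arg_min (reg_tree_cost P) (reg_tree_feasible P) (X, Y, Z) \<longrightarrow>
     (\<forall>ns\<in>tree_nodes P. Z ns = parent_state X ns))"

text \<open>Objective of the node problems at previous state \<open>u\<close> with future cost \<open>V\<close>.\<close>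

definition node_obj :: "('n, 'x::euclidean_space, 'y) msp \<Rightarrow> 'n \<Rightarrow> 'x \<Rightarrow> ('x \<Rightarrow> ereal) \<Rightarrow>
    'x \<times> 'y \<times> 'x \<Rightarrow> ereal" where
  "node_obj P m u V = (\<lambda>(x, y, z).
     cost P m z y x + ereal (sigma P m * penalty P m (u - z)) + V x)"

definition root_obj :: "('n, 'x::euclidean_space, 'y) msp \<Rightarrow> ('x \<Rightarrow> ereal) \<Rightarrow> 'x \<times> 'y \<Rightarrow> ereal" where
  "root_obj P V = (\<lambda>(x, y). cost P (root_node P) 0 y x + V x)"

function reg_value ::
    "('n, 'x::euclidean_space, 'y::euclidean_space) msp \<Rightarrow> nat \<Rightarrow> 'x \<Rightarrow> ereal" where
  "reg_value P t = (if t < horizon P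
     then (\<lambda>u. \<Sum>m\<in>nodes P (Suc t). ereal (prob P t m) *
            (INF w \<in> node_feas P (Suc t) m. node_obj P m u (reg_value P (Suc t)) w))
     else (\<lambda>_. 0))"
  by pat_completeness auto
termination
  by (relation "Wellfounded.measure (\<lambda>(P, t). horizon P - t)") auto

declare reg_value.simps [simp del]

definition reg_optimum :: "('n, 'x::euclidean_space, 'y::euclidean_space) msp \<Rightarrow> ereal" where
  "reg_optimum P = (INF w \<in> feas P (root_node P). root_obj P (reg_value P 0) w)"

definition eta_optimal_root ::
    "('n, 'x::euclidean_space, 'y::euclidean_space) msp \<Rightarrow> real \<Rightarrow> 'x \<times> 'y \<Rightarrow> bool" where
  "eta_optimal_root P \<eta> w \<longleftrightarrow> w \<in> feas P (root_node P) \<and>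
     root_obj P (reg_value P 0) w \<le> reg_optimum P + ereal \<eta>"

text \<open>
  A run stores the data of every iteration \<open>i\<close>. Here \<open>trial R i t\<close> is \<open>x\<^sub>t\<^sup>i\<close> (with
  \<open>t = 0\<close> for the root) and \<open>trial_y R i\<close> is \<open>y\<^sub>0\<^sup>i\<close>; \<open>fwd R i n\<close> is the triple
  \<open>(x\<^sub>n\<^sup>i, y\<^sub>n\<^sup>i, z\<^sub>n\<^sup>i)\<close>; \<open>mult R i n\<close> is \<open>(\<lambda>\<^sub>n\<^sup>i, \<rho>\<^sub>n\<^sup>i)\<close>; \<open>lowv\<close> and \<open>upv\<close> are the
  values \<open>v\<close> with lower and upper bar; \<open>lowQ\<close> and \<open>upQ\<close> are the cost-to-go approximations;
  \<open>lb R i\<close>, \<open>ub R i\<close> and \<open>best R i\<close> are LB, UB and \<open>(x\<^sub>0\<^sup>*, y\<^sub>0\<^sup>*)\<close> after iteration \<open>i\<close>,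
  with \<open>i = 0\<close> for the initialization. A run is a relation rather than a function because optimal
  solutions and the selected node are arbitrary; entries outside the performed iterations are
  unconstrained.
\<close>

record ('n, 'x, 'y) ddp_run =
  trial :: "nat \<Rightarrow> nat \<Rightarrow> 'x"
  trial_y :: "nat \<Rightarrow> 'y"
  fwd :: "nat \<Rightarrow> 'n \<Rightarrow> 'x \<times> 'y \<times> 'x"
  mult :: "nat \<Rightarrow> 'n \<Rightarrow> 'x \<times> real"
  lowv :: "nat \<Rightarrow> 'n \<Rightarrow> ereal"
  upv :: "nat \<Rightarrow> 'n \<Rightarrow> ereal"
  lowQ :: "nat \<Rightarrow> nat \<Rightarrow> 'x \<Rightarrow> ereal"
  upQ :: "nat \<Rightarrow> nat \<Rightarrow> 'x \<Rightarrow> ereal"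
  lb :: "nat \<Rightarrow> ereal"
  ub :: "nat \<Rightarrow> ereal"
  best :: "nat \<Rightarrow> 'x \<times> 'y"

definition ddp_init ::
    "('n, 'x::euclidean_space, 'y::euclidean_space) msp \<Rightarrow> ('n, 'x, 'y) ddp_run \<Rightarrow> bool" where
  "ddp_init P R \<longleftrightarrow>
     (\<forall>t<horizon P. \<forall>x\<in>stspace P t. lowQ R 0 t x = 0 \<and> upQ R 0 t x = \<infinity>) \<and>
     (\<forall>i x. lowQ R i (horizon P) x = 0 \<and> upQ R i (horizon P) x = 0) \<and>
     is_arg_min (root_obj P (\<lambda>_. 0)) (\<lambda>w. w \<in> feas P (root_node P)) (trial R 1 0, trial_y R 1) \<and>
     lb R 0 = root_obj P (\<lambda>_. 0) (trial R 1 0, trial_y R 1) \<and>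
     ub R 0 = \<infinity>"

definition gap :: "('n, 'x, 'y) ddp_run \<Rightarrow> nat \<Rightarrow> nat \<Rightarrow> 'n \<Rightarrow> ereal" where
  "gap R i t n = upQ R (i - 1) t (fst (fwd R i n)) - lowQ R (i - 1) t (fst (fwd R i n))"

definition forward_step :: "('n, 'x::euclidean_space, 'y::euclidean_space) msp \<Rightarrow>
    ('n, 'x, 'y) ddp_run \<Rightarrow> nat \<Rightarrow> nat \<Rightarrow> bool" where
  "forward_step P R i t \<longleftrightarrow>
     (\<forall>n\<in>nodes P t.
        is_arg_min (node_obj P n (trial R i (t - 1)) (lowQ R (i - 1) t))
          (\<lambda>w. w \<in> node_feas P t n) (fwd R i n)) \<and>
     (t < horizon P \<longrightarrow> (\<exists>k\<in>nodes P t.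
        (\<forall>n\<in>nodes P t. gap R i t n \<le> gap R i t k) \<and> trial R i t = fst (fwd R i k)))"

definition cut :: "('n, 'x::euclidean_space, 'y) msp \<Rightarrow> ('n, 'x, 'y) ddp_run \<Rightarrow>
    nat \<Rightarrow> nat \<Rightarrow> 'n \<Rightarrow> 'x \<Rightarrow> ereal" where
  "cut P R i t n x = (case mult R i n of (l, \<rho>) \<Rightarrow>
     ereal (- (l \<bullet> (trial R i (t - 1) - x)) - \<rho> * penalty P n (trial R i (t - 1) - x))
       + lowv R i n)"

definition upper_cone :: "('n, 'x::euclidean_space, 'y) msp \<Rightarrow> ('n, 'x, 'y) ddp_run \<Rightarrow>
    nat \<Rightarrow> nat \<Rightarrow> 'x \<Rightarrow> ereal" where
  "upper_cone P R i t x = (\<Sum>m\<in>nodes P (Suc t). ereal (prob P t m) *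
     (upv R i m + ereal (sigma P m * stnorm P t (x - trial R i t))))"

definition update_Q :: "('n, 'x::euclidean_space, 'y::euclidean_space) msp \<Rightarrow>
    ('n, 'x, 'y) ddp_run \<Rightarrow> nat \<Rightarrow> nat \<Rightarrow> bool" where
  "update_Q P R i t \<longleftrightarrow> (\<forall>x\<in>stspace P t.
     lowQ R i t x = max (lowQ R (i - 1) t x)
       (\<Sum>m\<in>nodes P (Suc t). ereal (prob P t m) * cut P R i (Suc t) m x) \<and>
     upQ R i t x =
       (if convex_problem P
        then conv_min_on (stspace P t) (upQ R (i - 1) t) (upper_cone P R i t) x
        else min (upQ R (i - 1) t x) (upper_cone P R i t x)))"

definition dual_inner :: "('n, 'x::euclidean_space, 'y::euclidean_space) msp \<Rightarrow>
    ('n, 'x, 'y) ddp_run \<Rightarrow> nat \<Rightarrow> nat \<Rightarrow> 'n \<Rightarrow> 'x \<times> real \<Rightarrow> ereal" where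
  "dual_inner P R i t n = (\<lambda>(l, \<rho>). INF (x, y, z) \<in> node_feas P t n.
     cost P n z y x + ereal (l \<bullet> (trial R i (t - 1) - z))
       + ereal (\<rho> * penalty P n (trial R i (t - 1) - z)) + lowQ R i t x)"

definition backward_step :: "('n, 'x::euclidean_space, 'y::euclidean_space) msp \<Rightarrow>
    ('n, 'x, 'y) ddp_run \<Rightarrow> nat \<Rightarrow> nat \<Rightarrow> bool" where
  "backward_step P R i t \<longleftrightarrow>
     (t < horizon P \<longrightarrow> update_Q P R i t) \<and>
     (\<forall>n\<in>nodes P t.
        is_arg_max (dual_inner P R i t n) (\<lambda>w. w \<in> dual_set P t n) (mult R i n) \<and>
        lowv R i n = (SUP w \<in> dual_set P t n. dual_inner P R i t n w) \<and>
        upv R i n = node_obj P n (trial R i (t - 1)) (upQ R i t) (fwd R i n))"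

definition root_step :: "('n, 'x::euclidean_space, 'y::euclidean_space) msp \<Rightarrow>
    ('n, 'x, 'y) ddp_run \<Rightarrow> nat \<Rightarrow> bool" where
  "root_step P R i \<longleftrightarrow>
     update_Q P R i 0 \<and>
     (let w = (trial R (i + 1) 0, trial_y R (i + 1)); c = root_obj P (upQ R i 0) w in
        is_arg_min (root_obj P (lowQ R i 0)) (\<lambda>w. w \<in> feas P (root_node P)) w \<and>
        lb R i = root_obj P (lowQ R i 0) w \<and>
        (if c < ub R (i - 1)
         then ub R i = c \<and> best R i = w
         else ub R i = ub R (i - 1) \<and> best R i = best R (i - 1)))"

definition ddp_iteration :: "('n, 'x::euclidean_space, 'y::euclidean_space) msp \<Rightarrow>
    ('n, 'x, 'y) ddp_run \<Rightarrow> nat \<Rightarrow> bool" where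
  "ddp_iteration P R i \<longleftrightarrow>
     (\<forall>t\<in>{1..horizon P}. forward_step P R i t) \<and>
     (\<forall>t\<in>{1..horizon P}. backward_step P R i t) \<and>
     root_step P R i"

text \<open>The termination index is the index of the last iteration that is performed.\<close>

definition ddp_terminates_at :: "('n, 'x::euclidean_space, 'y::euclidean_space) msp \<Rightarrow>
    real \<Rightarrow> ('n, 'x, 'y) ddp_run \<Rightarrow> nat \<Rightarrow> bool" where
  "ddp_terminates_at P \<eta> R i \<longleftrightarrow>
     ddp_init P R \<and>
     (\<forall>j\<in>{1..i}. ub R (j - 1) - lb R (j - 1) > ereal \<eta> \<and> ddp_iteration P R j) \<and>
     \<not> ub R i - lb R i > ereal \<eta>"

end

theory Submission
  imports Defs
begin

text \<open>
  If iteration \<open>j\<close> starts with \<open>UB - LB > T\<epsilon>\<close>, the gap between the upper and the lower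
  cost-to-go approximation at the root trial point exceeds \<open>T\<epsilon>\<close>, while it is zero at stage \<open>T\<close>.
  Hence there is a stage \<open>t\<close> at which the gap at the trial point exceeds \<open>(T - t)\<epsilon>\<close> and at
  stage \<open>t + 1\<close> is at most \<open>(T - t - 1)\<epsilon>\<close>. The cuts computed in the backward pass transfer the
  latter bound to stage \<open>t\<close>, up to an error \<open>2L\<^sub>t\<parallel>x - x\<^sub>t\<^sup>j\<parallel>\<close>. So the trial points of all iterations
  assigned to \<open>t\<close> are at distance at least \<open>\<epsilon>/(2L\<^sub>t)\<close> from each other, and a volume comparison bounds
  their number.
\<close>

subsection \<open>Norms on subspaces\<close>

text \<open>The transfer to stage t rests on one fact: although the multipliers are bounded, the
  dual value \<open>lowv\<close> is at least the value of the forward problem. If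
  \<open>rbound\<close> is at least \<open>sigma\<close>, the multiplier (0, \<open>sigma\<close>)
  reproduces the forward problem. In the convex case with norm penalties \<open>rbound\<close> is 0,
  so the penalty has to be replaced by a linear form of dual norm at most \<open>sigma\<close>; this
  is a separation argument, which uses that the accumulated cuts are convex. The factor 2 has two
  sources: away from the trial point a cut falls with slope at most \<open>lbound + rbound\<close>,
  and the upper cone rises with slope \<open>sigma\<close>, which is again at most
  \<open>lbound + rbound\<close>. The transfer needs the gaps at all nodes of stage t + 1, while the
  run keeps only one trial point there. The selection of a node with the largest gap closes this
  difference. Since lower approximations only grow and upper ones only shrink, what iteration i
  achieves around its trial point still holds when iteration j > i chooses its own.\<close>

lemma norm_on_zero: "norm_on S N \<Longrightarrow> subspace S \<Longrightarrow> N 0 = 0"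
  by (auto simp: norm_on_def subspace_0)

lemma norm_on_minus: "norm_on S N \<Longrightarrow> x \<in> S \<Longrightarrow> N (- x) = N x"
  unfolding norm_on_def by (metis abs_minus_cancel abs_one mult_1 scaleR_minus1_left)

lemma norm_on_commute:
  assumes "norm_on S N" "subspace S" "x \<in> S" "y \<in> S"
  shows "N (x - y) = N (y - x)"
  using norm_on_minus[OF assms(1) subspace_diff[OF assms(2) assms(3,4)]] by simp

lemma norm_on_sum_le:
  assumes "norm_on S N" "subspace S" "finite B" "B \<subseteq> S"
  shows "N (\<Sum>b\<in>B. u b *\<^sub>R b) \<le> (\<Sum>b\<in>B. \<bar>u b\<bar> * N b)"
  using assms(3,4)
proof (induction B rule: finite_induct)
  case empty
  then show ?case using norm_on_zero[OF assms(1,2)] by simp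
next
  case (insert b B)
  have S: "u b *\<^sub>R b \<in> S" "(\<Sum>b\<in>B. u b *\<^sub>R b) \<in> S"
    using insert.prems assms(2) by (auto intro!: subspace_sum subspace_scale)
  have "N (u b *\<^sub>R b + (\<Sum>b\<in>B. u b *\<^sub>R b)) \<le> N (u b *\<^sub>R b) + N (\<Sum>b\<in>B. u b *\<^sub>R b)"
    using S assms(1) by (auto simp: norm_on_def)
  also have "N (u b *\<^sub>R b) = \<bar>u b\<bar> * N b"
    using insert.prems assms(1) by (auto simp: norm_on_def)
  finally show ?case using insert by auto
qed

lemma norm_on_le_norm:
  fixes S :: "'x::euclidean_space set"
  assumes "norm_on S N" "subspace S"
  obtains M where "0 < M" "\<And>x. x \<in> S \<Longrightarrow> N x \<le> M * norm x"
proof -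
  obtain B where B: "B \<subseteq> S" "pairwise orthogonal B" "\<And>x. x \<in> B \<Longrightarrow> norm x = 1"
      "independent B" "card B = dim S" "span B = S"
    using orthonormal_basis_subspace[OF assms(2)] by blast
  have fin: "finite B" using B(4) by (simp add: finiteI_independent)
  have nn: "N b \<ge> 0" if "b \<in> B" for b using assms(1) B(1) that by (auto simp: norm_on_def)
  \<comment> \<open>The summand 1 keeps M positive when S is trivial and B is empty.\<close>
  define M where "M = (\<Sum>b\<in>B. N b) + 1"
  have "N x \<le> M * norm x" if "x \<in> S" for x
  proof -
    have "N x = N (\<Sum>b\<in>B. (x \<bullet> b) *\<^sub>R b)"
      using orthonormal_basis_expand[OF B(2,3) _ fin] B(6) that by auto
    also have "\<dots> \<le> (\<Sum>b\<in>B. \<bar>x \<bullet> b\<bar> * N b)"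
      by (rule norm_on_sum_le[OF assms fin B(1)])
    also have "\<dots> \<le> (\<Sum>b\<in>B. norm x * N b)"
    proof (rule sum_mono)
      fix b assume "b \<in> B"
      moreover have "\<bar>x \<bullet> b\<bar> \<le> norm x * norm b" by (rule Cauchy_Schwarz_ineq2)
      ultimately show "\<bar>x \<bullet> b\<bar> * N b \<le> norm x * N b" using nn B(3) by (auto intro: mult_right_mono)
    qed
    also have "\<dots> \<le> M * norm x" by (simp add: M_def sum_distrib_left algebra_simps)
    finally show ?thesis .
  qed
  moreover have "0 < M" using nn by (simp add: M_def add_nonneg_pos sum_nonneg)
  ultimately show ?thesis using that by blast
qed

lemma norm_on_continuous:
  fixes S :: "'x::euclidean_space set"
  assumes "norm_on S N" "subspace S"
  shows "continuous_on S N"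
proof -
  obtain M where M: "0 < M" "\<And>x. x \<in> S \<Longrightarrow> N x \<le> M * norm x"
    using norm_on_le_norm[OF assms] by blast
  have tri: "N x - N y \<le> N (x - y)" if "x \<in> S" "y \<in> S" for x y
  proof -
    have "N ((x - y) + y) \<le> N (x - y) + N y"
      using assms that subspace_diff unfolding norm_on_def by blast
    then show ?thesis by simp
  qed
  have "dist (N x) (N y) \<le> M * dist x y" if "x \<in> S" "y \<in> S" for x y
    using tri[OF that] tri[OF that(2,1)] norm_on_commute[OF assms that]
      M(2)[OF subspace_diff[OF assms(2) that]]
    by (auto simp: dist_real_def dist_norm)
  then have "M-lipschitz_on S N" using M(1) by (intro lipschitz_onI) auto
  then show ?thesis by (rule lipschitz_on_continuous_on)
qed

lemma norm_le_norm_on: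
  fixes S :: "'x::euclidean_space set"
  assumes "norm_on S N" "subspace S"
  obtains C where "0 < C" "\<And>x. x \<in> S \<Longrightarrow> norm x \<le> C * N x"
\<comment> \<open>An empty intersection with the unit sphere means S = {0}; otherwise N attains a
  positive minimum e on the compact intersection, and homogeneity extends the bound to S.\<close>
proof (cases "S \<inter> sphere 0 1 = {}")
  case True
  have "x = 0" if "x \<in> S" for x
  proof (rule ccontr)
    assume "x \<noteq> 0"
    then have "x /\<^sub>R norm x \<in> S \<inter> sphere 0 1" using that assms(2) by (auto intro: subspace_scale)
    with True show False by blast
  qed
  then show ?thesis using that[of 1] norm_on_zero[OF assms] by force
next
  case False
  have "compact (S \<inter> sphere 0 1)"
    using closed_subspace[OF assms(2)] by (simp add: closed_Int_compact)
  moreover have "continuous_on (S \<inter> sphere 0 1) N"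
    using norm_on_continuous[OF assms] continuous_on_subset by blast
  ultimately obtain e where e: "e \<in> S \<inter> sphere 0 1" "\<And>x. x \<in> S \<inter> sphere 0 1 \<Longrightarrow> N e \<le> N x"
    using continuous_attains_inf[OF _ False] by blast
  have "e \<noteq> 0" using e(1) by auto
  then have pos: "0 < N e" using e(1) assms(1) unfolding norm_on_def
    by (metis IntD1 order_le_less)
  have "norm x \<le> inverse (N e) * N x" if x: "x \<in> S" for x
  proof (cases "x = 0")
    case True
    then show ?thesis using norm_on_zero[OF assms] by simp
  next
    case False
    have "inverse (norm x) *\<^sub>R x \<in> S \<inter> sphere 0 1"
      using False x assms(2) by (auto intro: subspace_scale)
    then have "N e \<le> N (inverse (norm x) *\<^sub>R x)" by (rule e(2))
    also have "\<dots> = inverse (norm x) * N x" using assms(1) x by (simp add: norm_on_def)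
    finally show ?thesis using False pos by (simp add: field_simps)
  qed
  then show ?thesis using that[of "inverse (N e)"] pos by auto
qed

section \<open>Volumes under coordinate scaling and the packing bound\<close>

lemma measure_scale_coordinates:
  fixes K :: "'a::euclidean_space set"
  assumes "K \<in> sets borel" "\<And>b. b \<in> Basis \<Longrightarrow> c b > 0"
  shows "measure lborel K =
    (\<Prod>b\<in>Basis. c b) * measure lborel {x. (\<Sum>b\<in>Basis. (c b * (x \<bullet> b)) *\<^sub>R b) \<in> K}"
proof -
  \<comment> \<open>The summand 0 is the translation in \<open>lborel_affine_euclidean\<close>, kept
    so that the terms match.\<close>
  define T where "T = (\<lambda>x::'a. 0 + (\<Sum>b\<in>Basis. (c b * (x \<bullet> b)) *\<^sub>R b))"
  have T[measurable]: "T \<in> borel_measurable borel" unfolding T_def by measurable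
  have "lborel = density (distr lborel borel T) (\<lambda>_. (\<Prod>j\<in>Basis. \<bar>c j\<bar>))"
    unfolding T_def using assms(2) by (intro lborel_affine_euclidean) force
  then have "emeasure lborel K = emeasure (density (distr lborel borel T) (\<lambda>_. (\<Prod>j\<in>Basis. \<bar>c j\<bar>))) K"
    by simp
  also have "\<dots> = ennreal (\<Prod>j\<in>Basis. \<bar>c j\<bar>) * emeasure lborel (T -` K)"
    using assms(1) by (simp add: emeasure_density nn_integral_cmult emeasure_distr T)
  also have "(\<Prod>j\<in>Basis. \<bar>c j\<bar>) = (\<Prod>j\<in>Basis. c j)"
    using assms(2) by (intro prod.cong) (auto simp: less_imp_le)
  finally show ?thesis
    using assms(2) by (simp add: measure_def enn2real_mult T_def vimage_def prod_nonneg less_imp_le)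
qed

text \<open>
  The bound compares volumes. To measure sets in the subspace \<open>S\<close>, it is mapped isometrically
  onto a coordinate subspace and its balls are thickened to cylinders over the unit cube in the
  remaining coordinates; scaling by \<open>s\<close> along \<open>S\<close> multiplies their volume by \<open>s\<^bsup>dim S\<^esup>\<close>.
\<close>

lemma card_separated_le:
  fixes S :: "'x::euclidean_space set"
  assumes N: "norm_on S N" and S: "subspace S" and X: "finite X" "X \<subseteq> S" and c: "c \<in> S"
    and R0: "0 \<le> R" and R: "\<And>x. x \<in> X \<Longrightarrow> N (x - c) \<le> R" and r: "0 < r"
    and sep: "\<And>x y. x \<in> X \<Longrightarrow> y \<in> X \<Longrightarrow> x \<noteq> y \<Longrightarrow> r \<le> N (x - y)"
  shows "real (card X) \<le> (1 + 2 * R / r) ^ dim S"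
proof (cases "X = {}")
  case True
  then show ?thesis using R0 r by simp
next
  case False
  have Npos: "0 \<le> N x" if "x \<in> S" for x using N that by (simp add: norm_on_def)
  obtain B :: "'x set" where B: "B \<subseteq> Basis" "card B = dim S"
    using obtain_subset_with_card_n[of "dim S" "Basis :: 'x set"] dim_subset_UNIV[of S] by auto
  have finB: "finite B" using B(1) finite_Basis finite_subset by blast
  have "dim S = dim (span B)"
    using B(1,2) independent_mono[OF independent_Basis B(1)] dim_eq_card_independent by force
  then obtain f g where fg: "linear f" "linear g" "f ` S = span B" "g ` span B = S"
      "\<And>x. x \<in> S \<Longrightarrow> norm (f x) = norm x" "\<And>x. x \<in> span B \<Longrightarrow> norm (g x) = norm x"
      "\<And>x. x \<in> S \<Longrightarrow> g (f x) = x" "\<And>x. x \<in> span B \<Longrightarrow> f (g x) = x"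
    using isometries_subspaces[OF S subspace_span] by metis
  have Bb: "a \<bullet> b = (if a = b then 1 else 0)" if "a \<in> B" "b \<in> Basis" for a b
    using inner_Basis[of a b] that B(1) by auto
  define p where "p x = (\<Sum>b\<in>B. (x \<bullet> b) *\<^sub>R b)" for x :: 'x
  have p_lin: "linear p" unfolding p_def
    by (intro linear_compose_sum ballI) (simp add: linear_iff inner_add_left scaleR_add_left)
  have p_span: "p x \<in> span B" for x unfolding p_def by (intro span_sum span_scale span_base)
  have p_id: "p x = x" if "x \<in> span B" for x
    unfolding p_def using B(1) finB that
    by (intro orthonormal_basis_expand) (auto simp: pairwise_def orthogonal_def intro!: inner_not_same_Basis)
  have off: "x \<bullet> b = 0" if "x \<in> span B" "b \<in> Basis - B" for x b
  proof -
    have "x \<bullet> b = (\<Sum>a\<in>B. (x \<bullet> a) * (a \<bullet> b))"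
      using p_id[OF that(1)] unfolding p_def by (metis (no_types, lifting) inner_scaleR_left inner_sum_left sum.cong)
    also have "\<dots> = 0" using that(2) by (intro sum.neutral) (auto simp: Bb)
    finally show ?thesis .
  qed
  \<comment> \<open>N is pulled back along the isometry and extended to the whole space by ignoring
    the coordinates outside B. The result is only a seminorm, but it is defined where Lebesgue
    measure is nontrivial.\<close>
  define M where "M x = N (g (p x))" for x
  have gpS: "g (p x) \<in> S" for x using p_span fg(4) by blast
  have gp_lin: "linear (\<lambda>x. g (p x))" using linear_compose[OF p_lin fg(2)] by (simp add: o_def)
  have M_tri: "M (x + y) \<le> M x + M y" for x y
    using N gpS linear_add[OF gp_lin] by (simp add: M_def norm_on_def)
  have M_scale: "M (a *\<^sub>R x) = \<bar>a\<bar> * M x" for a x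
    using N gpS linear_scale[OF gp_lin] by (simp add: M_def norm_on_def)
  have M_minus: "M (x - y) \<le> M x + M y" for x y
    using M_tri[of x "- y"] M_scale[of "-1" y] by simp
  have M_f: "M (f x) = N x" if "x \<in> S" for x
    unfolding M_def using p_id[of "f x"] fg(7)[OF that] fg(3) that by force
  have M_cong: "M x = M y" if "p x = p y" for x y using that by (simp add: M_def)
  have "bounded_linear (\<lambda>x. g (p x))"
    using gp_lin by (simp add: linear_conv_bounded_linear)
  from continuous_on_compose2[OF norm_on_continuous[OF N S] linear_continuous_on[OF this]]
  have M_cont: "continuous_on UNIV M" using gpS unfolding M_def by blast
  obtain C where C: "0 < C" "\<And>x. x \<in> S \<Longrightarrow> norm x \<le> C * N x" using norm_le_norm_on[OF N S] by blast
  \<comment> \<open>The strict inequalities make the cylinder open, which gives measurability and,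
    for s = 1, positive volume.\<close>
  define K where "K s = {x. M x < s \<and> (\<forall>b\<in>Basis - B. \<bar>x \<bullet> b\<bar> < 1)}" for s
  have K_open: "open (K s)" for s
  proof -
    have "K s = {x. M x < s} \<inter> (\<Inter>b\<in>Basis - B. {x. \<bar>x \<bullet> b\<bar> < 1})" by (auto simp: K_def)
    moreover have "open {x. M x < s}" using M_cont by (intro open_Collect_less) (auto intro: continuous_intros)
    moreover have "open {x::'x. \<bar>x \<bullet> b\<bar> < 1}" for b by (intro open_Collect_less continuous_intros)
    ultimately show ?thesis by (auto intro!: open_Int open_INT)
  qed
  have K_bdd: "bounded (K s)" for s
  proof -
    \<comment> \<open>Coordinates in B are controlled by the norm of \<open>p x\<close>, the others
      by the cube; the sum of all coordinates then bounds the norm.\<close>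
    have "norm x \<le> (\<Sum>b\<in>(Basis::'x set). C * s + 1)" if "x \<in> K s" for x
    proof -
      have Ms: "M x < s" and M0: "0 \<le> M x" using that Npos gpS by (auto simp: K_def M_def)
      have np: "norm (p x) \<le> C * s"
        using C(2)[OF gpS, of x] fg(6)[OF p_span, of x] Ms C(1) unfolding M_def
        by (smt (verit) mult_strict_left_mono)
      have "\<bar>x \<bullet> b\<bar> \<le> C * s + 1" if b: "b \<in> Basis" for b
      proof (cases "b \<in> B")
        case True
        have "p x \<bullet> b = (\<Sum>a\<in>B. if a = b then x \<bullet> b else 0)"
          unfolding p_def inner_sum_left using b by (intro sum.cong) (auto simp: Bb)
        also have "\<dots> = x \<bullet> b" using True finB by simp
        finally have "\<bar>x \<bullet> b\<bar> \<le> norm (p x)" using Basis_le_norm[OF b, of "p x"] by simp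
        then show ?thesis using np by simp
      next
        case False
        then have "\<bar>x \<bullet> b\<bar> < 1" using \<open>x \<in> K s\<close> b by (simp add: K_def)
        moreover have "0 \<le> C * s" using C(1) Ms M0 by simp
        ultimately show ?thesis by simp
      qed
      then have "(\<Sum>b\<in>Basis. \<bar>x \<bullet> b\<bar>) \<le> (\<Sum>b\<in>(Basis::'x set). C * s + 1)" by (rule sum_mono)
      with norm_le_l1[of x] show ?thesis by (rule order_trans)
    qed
    then show ?thesis unfolding bounded_iff by blast
  qed
  have K_meas: "K s \<in> lmeasurable" for s using K_open K_bdd lmeasurable_open by blast
  have K_leb: "measure lebesgue (K s) = measure lborel (K s)" for s
    using borel_open[OF K_open[of s]] by (simp add: measure_completion)
  define \<mu> where "\<mu> = measure lebesgue (K 1)"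
  have mu_pos: "0 < \<mu>"
  proof -
    have "0 \<in> K 1" by (simp add: K_def M_def p_def norm_on_zero[OF N S] linear_0[OF fg(2)])
    then have "\<not> negligible (K 1)" using K_open open_not_negligible by blast
    then have "\<mu> \<noteq> 0" using K_meas[of 1] by (simp add: negligible_iff_measure \<mu>_def)
    then show ?thesis by (simp add: \<mu>_def zero_less_measure_iff)
  qed
  have K_vol: "measure lebesgue (K s) = s ^ dim S * \<mu>" if s: "0 < s" for s
  proof -
    define w where "w b = (if b \<in> B then s else 1)" for b
    \<comment> \<open>Stretching by s only along B multiplies M by s and leaves the cube alone, so
      the preimage of \<open>K s\<close> is \<open>K 1\<close>.\<close>
    define T where "T x = (\<Sum>b\<in>Basis. (w b * (x \<bullet> b)) *\<^sub>R b)" for x :: 'x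
    have Tb: "T x \<bullet> b = w b * (x \<bullet> b)" if "b \<in> Basis" for x b
      using that by (simp add: T_def inner_sum_left_Basis)
    have "p (T x) = p (s *\<^sub>R x)" for x
    proof -
      have "T x \<bullet> b = s * (x \<bullet> b)" if "b \<in> B" for b
        using Tb[of b x] that B(1) by (auto simp: w_def)
      then show ?thesis unfolding p_def by (intro sum.cong) simp_all
    qed
    from M_cong[OF this] have MT: "M (T x) = s * M x" for x using M_scale[of s x] s by simp
    have "T x \<bullet> b = x \<bullet> b" if "b \<in> Basis - B" for x b using Tb[of b x] that by (simp add: w_def)
    then have eq: "{x. T x \<in> K s} = K 1" using s by (simp add: K_def MT)
    have "(\<Prod>b\<in>Basis. w b) = s ^ dim S"
    proof -
      have "(\<Prod>b\<in>Basis. w b) = (\<Prod>b\<in>Basis - B. w b) * (\<Prod>b\<in>B. w b)"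
        by (rule prod.subset_diff[OF B(1) finite_Basis])
      also have "(\<Prod>b\<in>Basis - B. w b) = 1" by (intro prod.neutral) (auto simp: w_def)
      also have "(\<Prod>b\<in>B. w b) = (\<Prod>b\<in>B. s)" by (intro prod.cong) (auto simp: w_def)
      finally show ?thesis using B(2) by simp
    qed
    moreover have "measure lborel (K s) = (\<Prod>b\<in>Basis. w b) * measure lborel {x. T x \<in> K s}"
      unfolding T_def using s
      by (intro measure_scale_coordinates borel_open K_open) (auto simp: w_def)
    ultimately show ?thesis unfolding eq K_leb \<mu>_def by simp
  qed
  \<comment> \<open>Half the separation is the radius at which two translates cannot meet: a common
    point would give N (x - y) < r.\<close>
  define A where "A x = (+) (f x) ` K (r / 2)" for x
  have A_meas: "A x \<in> lmeasurable" for x unfolding A_def by (rule measurable_translation[OF K_meas])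
  have disj: "disjoint_family_on A X"
    unfolding disjoint_family_on_def
  proof (intro ballI impI)
    fix x y assume xy: "x \<in> X" "y \<in> X" "x \<noteq> y"
    show "A x \<inter> A y = {}"
    proof (rule ccontr)
      assume "A x \<inter> A y \<noteq> {}"
      then obtain k k' where k: "k \<in> K (r/2)" "k' \<in> K (r/2)" "f x + k = f y + k'" by (auto simp: A_def)
      have "N (x - y) = M (f x - f y)"
        using M_f[of "x - y"] xy X(2) S by (metis fg(1) linear_diff subsetD subspace_diff)
      also have "f x - f y = k' - k" using k(3) by (simp add: algebra_simps)
      also have "M (k' - k) < r" using M_minus[of k' k] k(1,2) by (simp add: K_def)
      finally show False using sep[OF xy] by simp
    qed
  qed
  have sub: "(\<Union>x\<in>X. A x) \<subseteq> (+) (f c) ` K (R + r / 2)"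
  proof
    fix w assume "w \<in> (\<Union>x\<in>X. A x)"
    then obtain x k where x: "x \<in> X" "k \<in> K (r/2)" "w = f x + k" by (auto simp: A_def)
    have xS: "x - c \<in> S" using x(1) X(2) S c subspace_diff by blast
    have e: "w - f c = f (x - c) + k" using x(3) by (simp add: linear_diff[OF fg(1)])
    have "M (f (x - c) + k) < R + r / 2"
      using M_tri[of "f (x - c)" k] M_f[OF xS] R[OF x(1)] x(2) by (simp add: K_def)
    \<comment> \<open>The centers differ only along \<open>span B\<close>, so the cube coordinates
      of k are not shifted.\<close>
    moreover have "f (x - c) \<bullet> b = 0" if "b \<in> Basis - B" for b using off[OF _ that] fg(3) xS by blast
    ultimately have "w - f c \<in> K (R + r/2)" using x(2) unfolding e by (simp add: K_def inner_add_left)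
    then show "w \<in> (+) (f c) ` K (R + r / 2)" by (intro image_eqI[of _ _ "w - f c"]) simp_all
  qed
  \<comment> \<open>Disjoint translates lie in one larger cylinder. The factor \<mu> cancels, and
    the ratio of the radii R + r/2 and r/2 is the base of the bound.\<close>
  have "real (card X) * ((r/2) ^ dim S * \<mu>) = (\<Sum>x\<in>X. measure lebesgue (A x))"
    using K_vol[of "r/2"] r by (simp add: A_def measure_translation)
  also have "\<dots> = measure lebesgue (\<Union>x\<in>X. A x)"
    using fmeasurableD2[OF A_meas]
    by (intro measure_finite_Union[symmetric] X(1) disj image_subsetI fmeasurableD[OF A_meas])
      (simp only: infinity_ennreal_def not_False_eq_True)
  also have "\<dots> \<le> measure lebesgue ((+) (f c) ` K (R + r / 2))"
    by (intro measure_mono_fmeasurable measurable_translation K_meas sub sets.finite_UN X(1)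
        fmeasurableD[OF A_meas])
  also have "\<dots> = (R + r / 2) ^ dim S * \<mu>" using K_vol[of "R + r/2"] R0 r by (simp add: measure_translation)
  finally have "real (card X) * (r/2) ^ dim S \<le> (R + r / 2) ^ dim S" using mu_pos by simp
  then have "real (card X) \<le> (R + r/2) ^ dim S / (r/2) ^ dim S" using r by (simp add: pos_le_divide_eq)
  also have "\<dots> = ((R + r/2) / (r/2)) ^ dim S" by (rule power_divide[symmetric])
  also have "(R + r/2) / (r/2) = 1 + 2 * R / r" using r by (simp add: field_simps)
  finally show ?thesis .
qed

subsection \<open>Dual norms and exactness of the norm penalty\<close>

lemma dual_norm_on_le:
  assumes "norm_on S N" "subspace S" "0 \<le> \<sigma>" "\<And>s. s \<in> S \<Longrightarrow> l \<bullet> s \<le> \<sigma> * N s"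
  shows "dual_norm_on S N l \<le> \<sigma>"
  unfolding dual_norm_on_def
proof (rule cSUP_least)
  show "{x \<in> S. N x \<le> 1} \<noteq> {}"
    using norm_on_zero[OF assms(1,2)] subspace_0[OF assms(2)] by force
next
  fix x assume "x \<in> {x \<in> S. N x \<le> 1}"
  then have "l \<bullet> x \<le> \<sigma> * N x" "\<sigma> * N x \<le> \<sigma> * 1"
    using assms(3,4) by (auto intro: mult_left_mono simp del: mult_1_right)
  then show "l \<bullet> x \<le> \<sigma>" by simp
qed

text \<open>The real supremum in \<open>dual_norm_on\<close> bounds its members only if they are
  bounded above; the comparison of N with the Euclidean norm provides this. The claim then follows
  by normalizing x.\<close>

lemma inner_le_dual_norm_on:
  fixes S :: "'x::euclidean_space set"
  assumes N: "norm_on S N" and S: "subspace S" and x: "x \<in> S"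
  shows "l \<bullet> x \<le> dual_norm_on S N l * N x"
proof (cases "x = 0")
  case True
  then show ?thesis using norm_on_zero[OF N S] by simp
next
  case False
  then have pos: "0 < N x" using N x unfolding norm_on_def by (metis order_le_less)
  obtain C where C: "0 < C" "\<And>y. y \<in> S \<Longrightarrow> norm y \<le> C * N y"
    using norm_le_norm_on[OF N S] by blast
  have "l \<bullet> y \<le> norm l * C" if "y \<in> S" "N y \<le> 1" for y
  proof -
    have "l \<bullet> y \<le> norm l * norm y" by (rule norm_cauchy_schwarz)
    also have "norm y \<le> C * 1" using C that by (meson mult_left_mono order_trans less_imp_le)
    finally show ?thesis by (simp add: mult_left_mono)
  qed
  then have bdd: "bdd_above ((\<lambda>y. l \<bullet> y) ` {x \<in> S. N x \<le> 1})" by (auto intro!: bdd_aboveI2)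
  have "inverse (N x) *\<^sub>R x \<in> {x \<in> S. N x \<le> 1}"
    using N S x pos by (auto simp: norm_on_def subspace_scale)
  then have "l \<bullet> (inverse (N x) *\<^sub>R x) \<le> dual_norm_on S N l"
    unfolding dual_norm_on_def by (rule cSUP_upper[OF _ bdd])
  then show ?thesis using pos by (simp add: field_simps)
qed

text \<open>
  Strong duality for the norm penalty: the epigraph-like set \<open>A\<close> is separated from the strict
  hypograph of \<open>v - \<sigma> N\<close>, and the separating hyperplane is not vertical because that hypograph
  projects onto the whole space.
\<close>

lemma norm_penalty_multiplier:
  fixes S :: "'x::euclidean_space set" and A :: "('x \<times> real) set"
  assumes N: "norm_on S N" and S: "subspace S" and \<sigma>: "0 \<le> \<sigma>"
    and A: "convex A" "A \<noteq> {}" "\<And>s a. (s, a) \<in> A \<Longrightarrow> s \<in> S \<and> v \<le> a + \<sigma> * N s"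
  obtains l where "l \<in> S" "\<And>s. s \<in> S \<Longrightarrow> l \<bullet> s \<le> \<sigma> * N s" "\<And>s a. (s, a) \<in> A \<Longrightarrow> v \<le> a + l \<bullet> s"
proof -
  obtain E where E: "E \<subseteq> S" "pairwise orthogonal E" "\<And>x. x \<in> E \<Longrightarrow> norm x = 1"
      "independent E" "card E = dim S" "span E = S"
    using orthonormal_basis_subspace[OF S] by blast
  have finE: "finite E" using E(4) by (simp add: finiteI_independent)
  \<comment> \<open>This p is the orthogonal projection onto S. Composed with N it gives a seminorm
    M on the whole space, so that separation can take place in the full product space.\<close>
  define p where "p x = (\<Sum>b\<in>E. (x \<bullet> b) *\<^sub>R b)" for x
  have p_lin: "linear p" unfolding p_def
    by (intro linear_compose_sum ballI) (simp add: linear_iff inner_add_left scaleR_add_left)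
  have pS: "p x \<in> S" for x unfolding p_def using E(1) by (intro subspace_sum[OF S] subspace_scale[OF S]) auto
  have p_id: "p x = x" if "x \<in> S" for x
    unfolding p_def using that E by (intro orthonormal_basis_expand[OF E(2,3) _ finE]) auto
  have p_orth: "(x - p x) \<bullet> s = 0" if "s \<in> S" for x s
  proof -
    have "(p x) \<bullet> s = x \<bullet> p s"
      by (simp add: p_def inner_sum_left inner_sum_right inner_commute mult.commute)
    then show ?thesis using p_id[OF that] by (simp add: inner_diff_left)
  qed
  define M where "M x = N (p x)" for x
  have M: "M (x + y) \<le> M x + M y" "M (c *\<^sub>R x) = \<bar>c\<bar> * M x" for x y c
    using N pS linear_add[OF p_lin] linear_scale[OF p_lin] by (simp_all add: M_def norm_on_def)
  define B where "B = {(s, b). b < v - \<sigma> * M s}"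
  have "convex B"
    unfolding convex_def
  proof (intro ballI allI impI)
    fix x y and u w :: real
    assume xy: "x \<in> B" "y \<in> B" and uw: "0 \<le> u" "0 \<le> w" "u + w = 1"
    obtain s b s' b' where x: "x = (s, b)" "y = (s', b')" by fastforce
    have b: "b < v - \<sigma> * M s" "b' < v - \<sigma> * M s'" using xy x by (auto simp: B_def)
    have "M (u *\<^sub>R s + w *\<^sub>R s') \<le> u * M s + w * M s'"
      using M(1)[of "u *\<^sub>R s" "w *\<^sub>R s'"] M(2)[of u s] M(2)[of w s'] uw by simp
    then have "\<sigma> * M (u *\<^sub>R s + w *\<^sub>R s') \<le> \<sigma> * (u * M s + w * M s')"
      using \<sigma> by (rule mult_left_mono)
    moreover have "u * b + w * b' < u * (v - \<sigma> * M s) + w * (v - \<sigma> * M s')"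
    \<comment> \<open>Strictness survives because one of the weights is positive.\<close>
    proof (cases "u = 0")
      case True
      then show ?thesis using b uw by simp
    next
      case False
      then have "u * b < u * (v - \<sigma> * M s)" using b uw by simp
      moreover have "w * b' \<le> w * (v - \<sigma> * M s')" using b uw by (intro mult_left_mono) auto
      ultimately show ?thesis by simp
    qed
    moreover have "u * (v - \<sigma> * M s) + w * (v - \<sigma> * M s') = (u + w) * v - \<sigma> * (u * M s + w * M s')"
      by (simp add: algebra_simps)
    ultimately show "u *\<^sub>R x + w *\<^sub>R y \<in> B" using uw x by (simp add: B_def)
  qed
  moreover have "B \<noteq> {}"
  proof -
    have "(0, v - \<sigma> * M 0 - 1) \<in> B" by (simp add: B_def)
    then show ?thesis by blast
  qed
  moreover have "B \<inter> A = {}"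
  proof -
    have False if "x \<in> B" "x \<in> A" for x
    proof -
      obtain s a where x: "x = (s, a)" by fastforce
      then have "s \<in> S" "v \<le> a + \<sigma> * N s" using A(3) that(2) by auto
      then show False using that(1) p_id x by (auto simp: B_def M_def)
    qed
    then show ?thesis by blast
  qed
  ultimately obtain ab c where ab: "ab \<noteq> 0" "\<forall>x\<in>B. ab \<bullet> x \<le> c" "\<forall>x\<in>A. c \<le> ab \<bullet> x"
    using separating_hyperplane_sets[of B A] A(1,2) by blast
  obtain \<alpha> \<beta> where [simp]: "ab = (\<alpha>, \<beta>)" by fastforce
  have sepB: "\<alpha> \<bullet> s + \<beta> * b \<le> c" if "b < v - \<sigma> * M s" for s b
    using ab(2) that by (auto simp: B_def)
  have sepA: "c \<le> \<alpha> \<bullet> s + \<beta> * a" if "(s, a) \<in> A" for s a using ab(3) that by auto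
  have "0 \<le> \<beta>"
  proof (rule ccontr)
    assume neg: "\<not> 0 \<le> \<beta>"
    \<comment> \<open>B is unbounded downwards: this b is low enough for (0, b) to lie in B and,
      with \<beta> negative, to push \<open>\<beta> * b\<close> to c + 1 or more.\<close>
    define b where "b = min (v - \<sigma> * M 0 - 1) ((c + 1) / \<beta>)"
    have "\<beta> * b \<le> c" using sepB[of b 0] by (simp add: b_def)
    moreover have "\<beta> * ((c + 1) / \<beta>) \<le> \<beta> * b" using neg by (intro mult_left_mono_neg) (auto simp: b_def)
    ultimately show False using neg by simp
  qed
  moreover have "\<beta> \<noteq> 0"
  proof
    assume b0: "\<beta> = 0"
    then have "\<alpha> \<noteq> 0" using ab(1) by (auto simp: zero_prod_def)
    \<comment> \<open>For a vertical hyperplane \<alpha> would be bounded above on the whole space;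
      along this multiple of \<alpha> its value is |c| + 1.\<close>
    define t where "t = (\<bar>c\<bar> + 1) / (\<alpha> \<bullet> \<alpha>)"
    have "\<alpha> \<bullet> (t *\<^sub>R \<alpha>) \<le> c"
      using sepB[of "v - \<sigma> * M (t *\<^sub>R \<alpha>) - 1" "t *\<^sub>R \<alpha>"] b0 by simp
    then show False using \<open>\<alpha> \<noteq> 0\<close> by (simp add: t_def)
  qed
  ultimately have \<beta>: "0 < \<beta>" by simp
  define l where "l = \<alpha> /\<^sub>R \<beta>"
  \<comment> \<open>The points of B lie strictly below v - \<sigma> M, so the bound on its boundary
    is obtained as a limit.\<close>
  have lB: "l \<bullet> s + (v - \<sigma> * M s) \<le> c / \<beta>" for s
  proof (rule field_le_epsilon)
    fix e :: real assume "0 < e"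
    have "\<alpha> \<bullet> s + \<beta> * (v - \<sigma> * M s - e) \<le> c" using \<open>0 < e\<close> by (intro sepB) simp
    then have "(\<alpha> \<bullet> s + \<beta> * (v - \<sigma> * M s - e)) / \<beta> \<le> c / \<beta>" using \<beta> by (intro divide_right_mono) auto
    moreover have "(\<alpha> \<bullet> s + \<beta> * (v - \<sigma> * M s - e)) / \<beta> = l \<bullet> s + (v - \<sigma> * M s - e)"
      using \<beta> by (simp add: l_def field_simps)
    ultimately show "l \<bullet> s + (v - \<sigma> * M s) \<le> c / \<beta> + e" by simp
  qed
  have lA: "c / \<beta> \<le> a + l \<bullet> s" if "(s, a) \<in> A" for s a
  proof -
    have "c / \<beta> \<le> (\<alpha> \<bullet> s + \<beta> * a) / \<beta>" using sepA[OF that] \<beta> by (intro divide_right_mono) auto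
    also have "\<dots> = a + l \<bullet> s" using \<beta> by (simp add: l_def field_simps)
    finally show ?thesis .
  qed
  have vc: "v \<le> c / \<beta>" using lB[of 0] M(2)[of 0 0] by simp
  have lM: "l \<bullet> s \<le> \<sigma> * M s" for s
  proof (rule ccontr)
    assume "\<not> l \<bullet> s \<le> \<sigma> * M s"
    then have d: "0 < l \<bullet> s - \<sigma> * M s" by simp
    \<comment> \<open>If the linear form exceeded \<sigma> M at s, then it would exceed it by an
      arbitrary amount at multiples of s; this k makes the excess c/\<beta> - v + 1, which
      \<open>lB\<close> forbids.\<close>
    define k where "k = (c / \<beta> - v + 1) / (l \<bullet> s - \<sigma> * M s)"
    have k0: "0 \<le> k" using d vc by (simp add: k_def)
    have "k * (l \<bullet> s - \<sigma> * M s) \<le> c / \<beta> - v"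
      using lB[of "k *\<^sub>R s"] M(2)[of k s] k0 by (simp add: algebra_simps)
    then show False using d by (simp add: k_def)
  qed
  have "l \<in> S"
  proof -
    \<comment> \<open>M vanishes on the component of l orthogonal to S, so \<open>lM\<close> forces
      that component to be zero.\<close>
    have "p (l - p l) = 0" using p_id[OF pS] by (simp add: linear_diff[OF p_lin])
    then have "l \<bullet> (l - p l) \<le> 0" using lM[of "l - p l"] norm_on_zero[OF N S] by (simp add: M_def)
    moreover have "p l \<bullet> (l - p l) = 0" using p_orth[OF pS, of l l] by (simp add: inner_commute)
    ultimately have "(l - p l) \<bullet> (l - p l) \<le> 0" by (simp add: inner_diff_left)
    then have "l = p l" by (metis eq_iff_diff_eq_0 inner_eq_zero_iff inner_ge_zero order_antisym)
    then show ?thesis using pS by metis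
  qed
  moreover have "l \<bullet> s \<le> \<sigma> * N s" if "s \<in> S" for s using lM[of s] p_id[OF that] by (simp add: M_def)
  moreover have "v \<le> a + l \<bullet> s" if "(s, a) \<in> A" for s a using lA[OF that] vc by simp
  ultimately show ?thesis using that by blast
qed

subsection \<open>Finite costs and state space geometry\<close>

text \<open>This is the Fenchel-Young half of biconjugation. It lets the convex and the nonconvex
  update be treated alike: either way the new upper approximation is at most the pointwise
  minimum.\<close>

lemma conv_min_on_le_min:
  assumes "x \<in> S"
  shows "conv_min_on S g h x \<le> min (g x) (h x)"
proof -
  let ?k = "\<lambda>x. min (g x) (h x)"
  have "ereal (l \<bullet> x) - ?k x \<le> conjugate_on S ?k l" for l
    unfolding conjugate_on_def using assms by (intro SUP_upper2[of x]) auto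
  \<comment> \<open>Exchanging c and k is safe in the extended reals because a, the inner product,
    is finite.\<close>
  moreover have "a - c \<le> k" if "a - k \<le> c" "\<bar>a\<bar> \<noteq> \<infinity>" for a c k :: ereal
    using that by (cases a; cases k; cases c) auto
  ultimately have "ereal (x \<bullet> l) - conjugate_on S ?k l \<le> ?k x" for l
    by (metis (lifting) inner_commute ereal_infinity_cases MInfty_neq_ereal(1) PInfty_neq_ereal(1) abs_ereal.simps(1))
  then show ?thesis unfolding conv_min_on_def conjugate_on_def[of S "conjugate_on S ?k"] by (rule SUP_least)
qed

lemma node_feas_prev: "(x, y, z) \<in> node_feas P t n \<Longrightarrow> 1 \<le> t \<Longrightarrow> z \<in> stset P (t - 1)"
  by (auto simp: node_feas_def prev_set_def)

context
  fixes P :: "('n, 'x::euclidean_space, 'y::euclidean_space) msp"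
  assumes problem: "stagewise_problem P"
begin

lemma horizon_pos: "1 \<le> horizon P"
  using problem by (simp add: stagewise_problem_def)

lemma root_nodes: "nodes P 0 = {root_node P}"
  using problem by (simp add: stagewise_problem_def)

lemma finite_nodes: "t \<le> horizon P \<Longrightarrow> finite (nodes P t)"
  using problem by (simp add: stagewise_problem_def)

lemma prob_pos: "t < horizon P \<Longrightarrow> m \<in> nodes P (Suc t) \<Longrightarrow> 0 < prob P t m"
  using problem by (simp add: stagewise_problem_def)

lemma prob_sum: "t < horizon P \<Longrightarrow> (\<Sum>m\<in>nodes P (Suc t). prob P t m) = 1"
  using problem by (simp add: stagewise_problem_def)

lemma stspace_subspace: "t < horizon P \<Longrightarrow> subspace (stspace P t)"
  using problem by (simp add: stagewise_problem_def)

lemma stspace_norm: "t < horizon P \<Longrightarrow> norm_on (stspace P t) (stnorm P t)"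
  using problem by (simp add: stagewise_problem_def)

lemma stset_subset: "t < horizon P \<Longrightarrow> stset P t \<subseteq> stspace P t"
  using problem by (simp add: stagewise_problem_def)

lemma fst_feas: "t < horizon P \<Longrightarrow> m \<in> nodes P t \<Longrightarrow> fst ` feas P m = stset P t"
  using problem by (simp add: stagewise_problem_def)

lemma feas_compact: "t \<le> horizon P \<Longrightarrow> m \<in> nodes P t \<Longrightarrow> compact (feas P m)"
  using problem by (simp add: stagewise_problem_def)

lemma cost_nonneg:
  assumes "t \<le> horizon P" "m \<in> nodes P t" "(x, y, z) \<in> node_feas P t m"
  shows "0 \<le> cost P m z y x"
proof -
  have "\<forall>(x, y, z)\<in>node_feas P t m. 0 \<le> cost P m z y x"
    using problem assms(1,2) by (simp add: stagewise_problem_def)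
  then show ?thesis using assms(3) by auto
qed

lemma nodes_nonempty:
  assumes "t \<le> horizon P"
  shows "nodes P t \<noteq> {}"
proof (cases t)
  case 0
  then show ?thesis by (simp add: root_nodes)
next
  case (Suc s)
  then show ?thesis using prob_sum[of s] assms by auto
qed

section \<open>The scenario tree and nodes of finite cost\<close>

lemma tree_data_in_nodes:
  assumes "ns \<in> tree_nodes P"
  shows "tree_data P ns \<in> nodes P (length ns)"
proof (cases ns rule: rev_cases)
  case Nil
  then show ?thesis by (simp add: tree_data_def root_nodes)
next
  case (snoc ms m)
  then have "ns ! length ms \<in> nodes P (Suc (length ms))"
    using assms by (auto simp: tree_nodes_def)
  then show ?thesis using snoc by (simp add: tree_data_def)
qed

lemma finite_tree_nodes: "finite (tree_nodes P)"
proof (rule finite_subset)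
  show "finite {ns. set ns \<subseteq> (\<Union>t\<le>horizon P. nodes P t) \<and> length ns \<le> horizon P}"
    using finite_nodes by (intro finite_lists_length_le) auto
  show "tree_nodes P \<subseteq> {ns. set ns \<subseteq> (\<Union>t\<le>horizon P. nodes P t) \<and> length ns \<le> horizon P}"
  proof
    fix ns assume ns: "ns \<in> tree_nodes P"
    have "m \<in> (\<Union>t\<le>horizon P. nodes P t)" if "m \<in> set ns" for m
    proof -
      obtain s where "s < length ns" "m = ns ! s" using \<open>m \<in> set ns\<close> by (auto simp: in_set_conv_nth)
      then have "m \<in> nodes P (Suc s)" "Suc s \<le> horizon P" using ns by (auto simp: tree_nodes_def)
      then show ?thesis by blast
    qed
    then show "ns \<in> {ns. set ns \<subseteq> (\<Union>t\<le>horizon P. nodes P t) \<and> length ns \<le> horizon P}"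
      using ns by (auto simp: tree_nodes_def)
  qed
qed

lemma tree_prob_pos: "ns \<in> tree_nodes P \<Longrightarrow> 0 < tree_prob P ns"
  unfolding tree_prob_def by (rule prod_pos) (auto simp: tree_nodes_def intro!: prob_pos)

lemma tree_feasible_node_feas:
  assumes "tree_feasible P X Y" "ns \<in> tree_nodes P"
  shows "(X ns, Y ns, parent_state X ns) \<in> node_feas P (length ns) (tree_data P ns)"
proof -
  have "parent_state X ns \<in> prev_set P (length ns)"
  proof (cases ns rule: rev_cases)
    case Nil
    then show ?thesis by (simp add: parent_state_def prev_set_def)
  next
    case (snoc ms m)
    then have ms: "ms \<in> tree_nodes P" "length ms < horizon P"
      using assms(2) by (auto simp: tree_nodes_def nth_append split: if_splits dest!: spec)
    then have "X ms \<in> stset P (length ms)"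
      using fst_feas[OF _ tree_data_in_nodes, of ms] assms(1) by (force simp: tree_feasible_def)
    then show ?thesis using snoc by (simp add: parent_state_def prev_set_def)
  qed
  then show ?thesis using assms by (simp add: node_feas_def tree_feasible_def)
qed

lemma exists_tree_node:
  assumes "t \<le> horizon P" "m \<in> nodes P t"
  obtains ns where "ns \<in> tree_nodes P" "length ns = t" "tree_data P ns = m"
proof (cases t)
  case 0
  then show ?thesis using that[of "[]"] assms by (simp add: tree_nodes_def tree_data_def root_nodes)
next
  case (Suc s)
  \<comment> \<open>By stagewise independence any choice of nodes at the earlier stages leads to
    m.\<close>
  define e where "e r = (SOME n. n \<in> nodes P (Suc r))" for r
  have e: "e r \<in> nodes P (Suc r)" if "r < s" for r
    unfolding e_def using nodes_nonempty[of "Suc r"] that Suc assms(1) by (intro some_in_eq[THEN iffD2]) auto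
  have "map e [0..<s] @ [m] \<in> tree_nodes P"
    using e assms Suc by (auto simp: tree_nodes_def nth_append less_Suc_eq)
  then show ?thesis using that[of "map e [0..<s] @ [m]"] Suc by (simp add: tree_data_def)
qed

text \<open>A finite sum of nonnegative terms with positive weights has only finite terms, and every
  node m supplies the data of some tree node.\<close>

lemma exists_finite_cost:
  assumes "finite_feasible P" "t \<le> horizon P" "m \<in> nodes P t"
  obtains x y z where "(x, y, z) \<in> node_feas P t m" "cost P m z y x < \<infinity>"
proof -
  obtain X Y where XY: "tree_feasible P X Y" "tree_cost P X Y < \<infinity>"
    using assms(1) by (auto simp: finite_feasible_def)
  obtain ns where ns: "ns \<in> tree_nodes P" "length ns = t" "tree_data P ns = m"
    using exists_tree_node[OF assms(2,3)] .
  define c where "c ms = ereal (tree_prob P ms) *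
    cost P (tree_data P ms) (parent_state X ms) (Y ms) (X ms)" for ms
  have nn: "0 \<le> c ms" if "ms \<in> tree_nodes P" for ms
  proof -
    have "length ms \<le> horizon P" using that by (simp add: tree_nodes_def)
    then have "0 \<le> cost P (tree_data P ms) (parent_state X ms) (Y ms) (X ms)"
      using tree_data_in_nodes[OF that] tree_feasible_node_feas[OF XY(1) that] by (rule cost_nonneg)
    then show ?thesis using tree_prob_pos[OF that] by (simp add: c_def)
  qed
  have "sum c {ns} \<le> sum c (tree_nodes P)"
    using finite_tree_nodes ns(1) nn by (intro sum_mono2) auto
  also have "\<dots> < \<infinity>" using XY(2) by (simp add: tree_cost_def c_def)
  finally have "cost P m (parent_state X ns) (Y ns) (X ns) < \<infinity>"
    using tree_prob_pos[OF ns(1)] ns(3)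
    by (cases "cost P m (parent_state X ns) (Y ns) (X ns)") (auto simp: c_def)
  moreover have "(X ns, Y ns, parent_state X ns) \<in> node_feas P t m"
    using tree_feasible_node_feas[OF XY(1) ns(1)] ns by simp
  ultimately show ?thesis using that by blast
qed

lemma node_feas_fst:
  assumes "t < horizon P" "n \<in> nodes P t" "(x, y, z) \<in> node_feas P t n"
  shows "x \<in> stset P t"
proof -
  have "fst (x, y) \<in> fst ` feas P n" using assms(3) by (intro imageI) (simp add: node_feas_def)
  then show ?thesis by (simp add: fst_feas[OF assms(1,2)])
qed

text \<open>The diameter is an infimum, so a ball is taken within e of it. Compactness of the
  feasible set makes the infimum range over a nonempty set.\<close>

lemma exists_ball_near_diameter:
  assumes t: "t < horizon P" and e: "0 < e"
  shows "\<exists>c\<in>stspace P t. \<exists>r\<ge>0. (\<forall>x\<in>stset P t. stnorm P t (x - c) \<le> r) \<and>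
    2 * r < state_diameter P t + e"
proof -
  let ?S = "stspace P t" and ?N = "stnorm P t" and ?X = "stset P t"
  define B where "B = {2 * r | r. 0 \<le> r \<and> (\<exists>c\<in>?S. \<forall>x\<in>?X. ?N (x - c) \<le> r)}"
  obtain n where n: "n \<in> nodes P t" using nodes_nonempty[OF less_imp_le[OF t]] by blast
  have "bounded (fst ` feas P n)"
    using feas_compact[OF _ n] t by (intro bounded_fst compact_imp_bounded) auto
  then obtain b where b: "0 < b" "\<And>x. x \<in> ?X \<Longrightarrow> norm x \<le> b"
    using fst_feas[OF t n] by (auto simp: bounded_pos)
  obtain M where M: "0 < M" "\<And>x. x \<in> ?S \<Longrightarrow> ?N x \<le> M * norm x"
    using norm_on_le_norm[OF stspace_norm[OF t] stspace_subspace[OF t]] by blast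
  have "?N (x - 0) \<le> M * b" if "x \<in> ?X" for x
  proof -
    have "?N x \<le> M * norm x" using M(2) that stset_subset[OF t] by blast
    also have "\<dots> \<le> M * b" using b(2)[OF that] M(1) by simp
    finally show ?thesis by simp
  qed
  moreover have "0 \<in> ?S" using stspace_subspace[OF t] by (rule subspace_0)
  ultimately have "2 * (M * b) \<in> B" unfolding B_def using b(1) M(1) by fastforce
  then have ne: "B \<noteq> {}" by blast
  have "Inf B < state_diameter P t + e"
    using e by (simp add: state_diameter_def ball_diameter_on_def B_def)
  from cInf_lessD[OF ne this] obtain d where d: "d \<in> B" "d < state_diameter P t + e" ..
  from d(1) obtain r where "d = 2 * r" "0 \<le> r" "\<exists>c\<in>?S. \<forall>x\<in>?X. ?N (x - c) \<le> r"
    unfolding B_def by blast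
  then show ?thesis using d(2) by blast
qed

lemma state_diameter_nonneg:
  assumes "t < horizon P"
  shows "0 \<le> state_diameter P t"
proof -
  obtain c r where "c \<in> stspace P t" "0 \<le> r" "\<forall>x\<in>stset P t. stnorm P t (x - c) \<le> r"
    using exists_ball_near_diameter[OF assms zero_less_one] by blast
  then have "2 * r \<in> {2 * r | r. 0 \<le> r \<and> (\<exists>c\<in>stspace P t. \<forall>x\<in>stset P t. stnorm P t (x - c) \<le> r)}"
    by blast
  then show ?thesis
    unfolding state_diameter_def ball_diameter_on_def by (intro cInf_greatest) auto
qed

text \<open>The packing bound holds with diameter D + e for every e > 0, and the right-hand side is
  continuous in e. Indices are counted instead of points; the separation makes f injective.\<close>

lemma card_separated_states_le:
  fixes f :: "nat \<Rightarrow> 'x"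
  assumes t: "t < horizon P" and J: "finite J" "f ` J \<subseteq> stset P t" and r: "0 < r"
    and sep: "\<And>i j. i \<in> J \<Longrightarrow> j \<in> J \<Longrightarrow> i < j \<Longrightarrow> r \<le> stnorm P t (f j - f i)"
  shows "real (card J) \<le> (1 + state_diameter P t / r) ^ dim (stspace P t)"
proof -
  let ?S = "stspace P t" and ?N = "stnorm P t" and ?D = "state_diameter P t"
  note N = stspace_norm[OF t] and S = stspace_subspace[OF t]
  have fS: "f i \<in> ?S" if "i \<in> J" for i using that J(2) stset_subset[OF t] by blast
  have sep': "r \<le> ?N (f i - f j)" if "i \<in> J" "j \<in> J" "i \<noteq> j" for i j
    using sep[of i j] sep[of j i] that norm_on_commute[OF N S fS fS, of i j] by (cases "i < j") auto
  have inj: "inj_on f J"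
  proof (rule inj_onI, rule ccontr)
    fix i j assume ij: "i \<in> J" "j \<in> J" "f i = f j" "i \<noteq> j"
    then show False using sep'[OF ij(1,2,4)] r norm_on_zero[OF N S] by simp
  qed
  have bound: "real (card J) \<le> (1 + (?D + e) / r) ^ dim ?S" if e: "0 < e" for e
  proof -
    obtain c \<rho> where c: "c \<in> ?S" "0 \<le> \<rho>" "\<forall>x\<in>stset P t. ?N (x - c) \<le> \<rho>" "2 * \<rho> < ?D + e"
      using exists_ball_near_diameter[OF t e] by blast
    have "real (card (f ` J)) \<le> (1 + 2 * \<rho> / r) ^ dim ?S"
    proof (rule card_separated_le[OF N S _ _ c(1,2)])
      show "finite (f ` J)" "f ` J \<subseteq> ?S" using J(1) fS by auto
      show "?N (x - c) \<le> \<rho>" if "x \<in> f ` J" for x using c(3) J(2) that by blast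
      show "r \<le> ?N (x - y)" if "x \<in> f ` J" "y \<in> f ` J" "x \<noteq> y" for x y using that sep' by auto
    qed (rule r)
    also have "\<dots> \<le> (1 + (?D + e) / r) ^ dim ?S"
      using c(2,4) r by (intro power_mono) (auto simp: divide_right_mono)
    finally show ?thesis by (simp add: card_image[OF inj])
  qed
  have "((\<lambda>e. (1 + (?D + e) / r) ^ dim ?S) \<longlongrightarrow> (1 + (?D + 0) / r) ^ dim ?S) (at_right 0)"
    using r by (intro tendsto_intros) auto
  moreover have "\<forall>\<^sub>F e in at_right 0. real (card J) \<le> (1 + (?D + e) / r) ^ dim ?S"
    using bound by (auto simp: eventually_at_filter)
  ultimately have "real (card J) \<le> (1 + (?D + 0) / r) ^ dim ?S"
    by (intro tendsto_lowerbound) auto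
  then show ?thesis by simp
qed

end

subsection \<open>Gaps along a run\<close>

locale ddp_run_setting =
  fixes P :: "('n, 'x::euclidean_space, 'y::euclidean_space) msp"
    and R :: "('n, 'x, 'y) ddp_run" and \<eta> :: real and K :: nat
  assumes problem: "stagewise_problem P" and feasible: "finite_feasible P"
    and reg: "regularization P" and dual: "dual_bounds P"
    and run: "ddp_terminates_at P \<eta> R K"
begin

text \<open>At stage T the problem specifies no state space, and the approximations there are zero
  everywhere, hence \<open>UNIV\<close>.\<close>

definition state_dom :: "nat \<Rightarrow> 'x set" where
  "state_dom t = (if t < horizon P then stspace P t else UNIV)"

lemma sigma_pos: "t \<le> horizon P \<Longrightarrow> m \<in> nodes P t \<Longrightarrow> 0 < sigma P m"
  using reg by (simp add: regularization_def)

lemma penalty_penalty_on: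
  assumes "t < horizon P" "m \<in> nodes P (Suc t)"
  shows "penalty_on (stspace P t) (penalty P m)"
proof -
  have "penalty_on (prev_space P (Suc t)) (penalty P m)"
    using reg assms by (simp add: regularization_def)
  then show ?thesis by (simp add: prev_space_def)
qed

lemma penalty_le_norm:
  assumes t: "t < horizon P" and m: "m \<in> nodes P (Suc t)" and ab: "a \<in> stset P t" "b \<in> stset P t"
  shows "penalty P m (a - b) \<le> stnorm P t (a - b)"
proof -
  let ?D = "{a - b | a b. a \<in> stset P t \<and> b \<in> stset P t}"
  have "a - b \<in> ?D" "0 \<in> ?D" using ab by force+
  moreover have "\<forall>u\<in>?D. \<forall>v\<in>?D. \<bar>penalty P m u - penalty P m v\<bar> \<le> stnorm P t (u - v)"
    using reg t m unfolding regularization_def by blast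
  ultimately have "\<bar>penalty P m (a - b) - penalty P m 0\<bar> \<le> stnorm P t (a - b - 0)" by blast
  moreover have "penalty P m 0 = 0"
    using penalty_penalty_on[OF t m] subspace_0[OF stspace_subspace[OF problem t]] by (auto simp: penalty_on_def)
  ultimately show ?thesis by simp
qed

lemma bounds_nonneg:
  assumes "t < horizon P" "m \<in> nodes P (Suc t)"
  shows "0 \<le> lbound P m" "0 \<le> rbound P m" "sigma P m \<le> lbound P m + rbound P m"
  using dual assms unfolding dual_bounds_def by (smt (verit))+

lemma lip_const_pos:
  assumes "t < horizon P"
  shows "0 < lip_const P t"
  unfolding lip_const_def
proof (rule sum_pos)
  show "finite (nodes P (Suc t))" "nodes P (Suc t) \<noteq> {}"
    using finite_nodes[OF problem] nodes_nonempty[OF problem] assms by auto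
  fix m assume m: "m \<in> nodes P (Suc t)"
  have "0 < lbound P m + rbound P m"
    using bounds_nonneg[OF assms m] sigma_pos[OF _ m] assms by simp
  then show "0 < prob P t m * (lbound P m + rbound P m)" using prob_pos[OF problem assms m] by simp
qed

lemma iteration:
  assumes "j \<in> {1..K}"
  shows "t \<in> {1..horizon P} \<Longrightarrow> forward_step P R j t"
    and "t \<in> {1..horizon P} \<Longrightarrow> backward_step P R j t"
    and "root_step P R j" and "ereal \<eta> < ub R (j - 1) - lb R (j - 1)"
  using run assms by (auto simp: ddp_terminates_at_def ddp_iteration_def)

lemma update:
  assumes "j \<in> {1..K}" "t < horizon P"
  shows "update_Q P R j t"
proof (cases "t = 0")
  case True
  then show ?thesis using iteration(3)[OF assms(1)] by (simp add: root_step_def)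
next
  case False
  then show ?thesis using iteration(2)[OF assms(1), of t] assms(2) by (simp add: backward_step_def)
qed

lemma init: "ddp_init P R"
  using run by (simp add: ddp_terminates_at_def)

text \<open>The first trial point comes from the initialization, whose cost-to-go is zero
  everywhere, whereas \<open>lowQ R 0 0\<close> is specified as zero only on the state
  space.\<close>

lemma root_trial:
  assumes "j \<in> {1..K}"
  shows "is_arg_min (root_obj P (if j = 1 then (\<lambda>_. 0) else lowQ R (j - 1) 0))
    (\<lambda>w. w \<in> feas P (root_node P)) (trial R j 0, trial_y R j)"
proof (cases "j = 1")
  case True
  then show ?thesis using init by (simp add: ddp_init_def)
next
  case False
  then have j: "j - 1 \<in> {1..K}" "j - 1 + 1 = j" using assms by auto
  show ?thesis using iteration(3)[OF j(1)] False j(2) by (simp add: root_step_def Let_def)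
qed

lemma fwd_arg_min:
  assumes "j \<in> {1..K}" "t \<in> {1..horizon P}" "n \<in> nodes P t"
  shows "is_arg_min (node_obj P n (trial R j (t - 1)) (lowQ R (j - 1) t))
    (\<lambda>w. w \<in> node_feas P t n) (fwd R j n)"
  using iteration(1)[OF assms(1,2)] assms(3) by (simp add: forward_step_def)

lemma fwd_in: "j \<in> {1..K} \<Longrightarrow> t \<in> {1..horizon P} \<Longrightarrow> n \<in> nodes P t \<Longrightarrow> fwd R j n \<in> node_feas P t n"
  using fwd_arg_min by (simp add: is_arg_min_def)

lemma node_feas_state:
  assumes "t \<le> horizon P" "n \<in> nodes P t" "(x, y, z) \<in> node_feas P t n"
  shows "x \<in> state_dom t"
  using node_feas_fst[OF problem _ assms(2,3)] stset_subset[OF problem, of t]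
  by (auto simp: state_dom_def)

lemma trial_in:
  assumes j: "j \<in> {1..K}" and t: "t < horizon P"
  shows "trial R j t \<in> stset P t"
proof (cases "t = 0")
  case True
  have "(trial R j 0, trial_y R j) \<in> feas P (root_node P)"
    using root_trial[OF j] by (simp add: is_arg_min_def)
  then have "trial R j 0 \<in> fst ` feas P (root_node P)" by force
  then show ?thesis using True fst_feas[OF problem t] root_nodes[OF problem] by simp
next
  case False
  then have t': "t \<in> {1..horizon P}" using t by simp
  obtain k where k: "k \<in> nodes P t" "trial R j t = fst (fwd R j k)"
    using iteration(1)[OF j t'] t by (auto simp: forward_step_def)
  obtain x y z where "fwd R j k = (x, y, z)" by (cases "fwd R j k")
  then show ?thesis using fwd_in[OF j t' k(1)] k(2) node_feas_fst[OF problem t k(1)] by simp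
qed

section \<open>Finiteness of the lower approximations\<close>

lemma zero_in_dual_set:
  assumes "t < horizon P" "n \<in> nodes P (Suc t)" "0 \<le> \<rho>" "\<rho> \<le> rbound P n"
  shows "(0, \<rho>) \<in> dual_set P (Suc t) n"
proof -
  note N = stspace_norm[OF problem assms(1)] and S = stspace_subspace[OF problem assms(1)]
  have "dual_norm_on (stspace P t) (stnorm P t) 0 \<le> 0" by (rule dual_norm_on_le[OF N S]) auto
  then show ?thesis
    using assms(3,4) bounds_nonneg(1)[OF assms(1,2)] subspace_0[OF S] by (simp add: dual_set_def)
qed

text \<open>From below, the multiplier (0, 0) leaves only nonnegative terms. From above, the
  supremum is attained at \<open>mult R j n\<close>, where the inner infimum is at most its value at
  a point of finite cost. The bounds on \<open>lowQ\<close> are assumed here because the lemma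
  serves inside their induction.\<close>

lemma lowv_finite_aux:
  assumes t: "t < horizon P" and n: "n \<in> nodes P (Suc t)" and b: "backward_step P R j (Suc t)"
    and Q: "\<forall>x\<in>state_dom (Suc t). 0 \<le> lowQ R j (Suc t) x \<and> lowQ R j (Suc t) x < \<infinity>"
  shows "0 \<le> lowv R j n \<and> lowv R j n < \<infinity>"
proof
  have t': "Suc t \<le> horizon P" using t by simp
  have lv: "lowv R j n = (SUP w \<in> dual_set P (Suc t) n. dual_inner P R j (Suc t) n w)"
    and am: "is_arg_max (dual_inner P R j (Suc t) n) (\<lambda>w. w \<in> dual_set P (Suc t) n) (mult R j n)"
    using b n by (simp_all add: backward_step_def)
  have "0 \<le> dual_inner P R j (Suc t) n (0, 0)"
    unfolding dual_inner_def prod.case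
  proof (rule INF_greatest)
    fix w assume "w \<in> node_feas P (Suc t) n"
    moreover obtain x y z where w: "w = (x, y, z)" by (cases w)
    ultimately have "0 \<le> cost P n z y x" "0 \<le> lowQ R j (Suc t) x"
      using cost_nonneg[OF problem t' n] Q node_feas_state[OF t' n] by auto
    then show "0 \<le> (case w of (x, y, z) \<Rightarrow> cost P n z y x + ereal (0 \<bullet> (trial R j (Suc t - 1) - z))
        + ereal (0 * penalty P n (trial R j (Suc t - 1) - z)) + lowQ R j (Suc t) x)"
      by (simp add: w)
  qed
  then show "0 \<le> lowv R j n"
    unfolding lv using zero_in_dual_set[OF t n, of 0] bounds_nonneg(2)[OF t n] by (intro SUP_upper2) auto
  obtain x y z where w: "(x, y, z) \<in> node_feas P (Suc t) n" "cost P n z y x < \<infinity>"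
    by (rule exists_finite_cost[OF problem feasible t' n])
  have "lowv R j n \<le> dual_inner P R j (Suc t) n (mult R j n)"
    unfolding lv using am by (intro SUP_least) (auto simp: is_arg_max_def not_less)
  also have "\<dots> < \<infinity>"
  proof -
    obtain l \<rho> where lr: "mult R j n = (l, \<rho>)" by (cases "mult R j n")
    let ?u = "trial R j (Suc t - 1)"
    have "dual_inner P R j (Suc t) n (l, \<rho>) \<le> cost P n z y x + ereal (l \<bullet> (?u - z))
       + ereal (\<rho> * penalty P n (?u - z)) + lowQ R j (Suc t) x"
      unfolding dual_inner_def prod.case by (rule INF_lower2[OF w(1)]) simp
    also have "\<dots> < \<infinity>" using w(2) Q node_feas_state[OF t' n w(1)] by simp
    finally show ?thesis using lr by simp
  qed
  finally show "lowv R j n < \<infinity>" .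
qed

text \<open>The outer induction runs forward over iterations, the inner one backward over stages:
  the cuts of stage t use dual values computed from the already updated approximation of stage t +
  1.\<close>

lemma lowQ_finite:
  assumes "j \<le> K" "t \<le> horizon P" "x \<in> state_dom t"
  shows "0 \<le> lowQ R j t x \<and> lowQ R j t x < \<infinity>"
  using assms
proof (induction j arbitrary: t x)
  case 0
  then show ?case using init by (cases "t = horizon P") (auto simp: ddp_init_def state_dom_def)
next
  case (Suc j)
  have "\<forall>x\<in>state_dom t. 0 \<le> lowQ R (Suc j) t x \<and> lowQ R (Suc j) t x < \<infinity>"
    using \<open>t \<le> horizon P\<close>
  proof (induction t rule: inc_induct)
    case base
    then show ?case using init by (simp add: ddp_init_def)
  next
    case (step t)
    have j: "Suc j \<in> {1..K}" using Suc.prems by simp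
    have b: "backward_step P R (Suc j) (Suc t)" using iteration(2)[OF j, of "Suc t"] step.hyps by simp
    show ?case
    proof
      fix x assume x: "x \<in> state_dom t"
      then have eq: "lowQ R (Suc j) t x = max (lowQ R j t x)
          (\<Sum>m\<in>nodes P (Suc t). ereal (prob P t m) * cut P R (Suc j) (Suc t) m x)"
        using update[OF j step.hyps(2)] step.hyps by (simp add: update_Q_def state_dom_def)
      have IH: "0 \<le> lowQ R j t x \<and> lowQ R j t x < \<infinity>"
        using Suc.IH[of t x] Suc.prems(1) step.hyps x by simp
      have "ereal (prob P t m) * cut P R (Suc j) (Suc t) m x \<noteq> \<infinity>" if "m \<in> nodes P (Suc t)" for m
        using lowv_finite_aux[OF step.hyps(2) that b step.IH]
        by (cases "lowv R (Suc j) m") (auto simp: cut_def split: prod.split)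
      then have "(\<Sum>m\<in>nodes P (Suc t). ereal (prob P t m) * cut P R (Suc j) (Suc t) m x) \<noteq> \<infinity>"
        by (auto simp: sum_Pinfty)
      \<comment> \<open>Nonnegativity is inherited through the maximum, so the cuts only have to
        stay below infinity.\<close>
      then show "0 \<le> lowQ R (Suc j) t x \<and> lowQ R (Suc j) t x < \<infinity>"
        using IH unfolding eq by (auto simp: max_def)
    qed
  qed
  then show ?case using Suc.prems by blast
qed

lemma lowv_finite:
  assumes "j \<in> {1..K}" "t < horizon P" "n \<in> nodes P (Suc t)"
  shows "0 \<le> lowv R j n" "lowv R j n < \<infinity>"
  using lowv_finite_aux[OF assms(2,3) iteration(2)[OF assms(1)]] lowQ_finite[of j "Suc t"] assms(1,2)
  by auto

section \<open>Monotonicity of the approximations\<close>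

lemma lowQ_step_mono:
  assumes "j \<in> {1..K}" "t \<le> horizon P" "x \<in> state_dom t"
  shows "lowQ R (j - 1) t x \<le> lowQ R j t x"
proof (cases "t = horizon P")
  case True
  then show ?thesis using init by (simp add: ddp_init_def)
next
  case False
  then have t: "t < horizon P" "x \<in> stspace P t" using assms by (auto simp: state_dom_def)
  then show ?thesis using update[OF assms(1) t(1)] by (simp add: update_Q_def)
qed

lemma upQ_step:
  assumes "j \<in> {1..K}" "t < horizon P" "x \<in> stspace P t"
  shows "upQ R j t x \<le> upQ R (j - 1) t x" "upQ R j t x \<le> upper_cone P R j t x"
proof -
  have "upQ R j t x \<le> min (upQ R (j - 1) t x) (upper_cone P R j t x)"
    using update[OF assms(1,2)] assms(3) conv_min_on_le_min[OF assms(3)]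
    by (simp add: update_Q_def)
  then show "upQ R j t x \<le> upQ R (j - 1) t x" "upQ R j t x \<le> upper_cone P R j t x" by auto
qed

lemma upQ_step_mono:
  assumes "j \<in> {1..K}" "t \<le> horizon P" "x \<in> state_dom t"
  shows "upQ R j t x \<le> upQ R (j - 1) t x"
proof (cases "t = horizon P")
  case True
  then show ?thesis using init by (simp add: ddp_init_def)
next
  case False
  then show ?thesis using upQ_step(1)[OF assms(1)] assms(2,3) by (simp add: state_dom_def)
qed

lemma gap_mono:
  assumes "i \<le> j" "j \<le> K" "t \<le> horizon P" "x \<in> state_dom t"
  shows "upQ R j t x - lowQ R j t x \<le> upQ R i t x - lowQ R i t x"
  using assms(1,2)
proof (induction j rule: dec_induct)
  case base
  then show ?case by simp
next
  case (step j)
  then have "upQ R (Suc j) t x - lowQ R (Suc j) t x \<le> upQ R j t x - lowQ R j t x"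
    using upQ_step_mono[OF _ assms(3,4), of "Suc j"] lowQ_step_mono[OF _ assms(3,4), of "Suc j"]
    by (intro ereal_minus_mono) simp_all
  also have "\<dots> \<le> upQ R i t x - lowQ R i t x" using step by simp
  finally show ?case .
qed

section \<open>Forward values and strong duality in the backward pass\<close>

lemma fwd_cost_finite:
  assumes j: "j \<in> {1..K}" and t: "t < horizon P" and n: "n \<in> nodes P (Suc t)"
    and w: "fwd R j n = (x, y, z)"
  shows "0 \<le> cost P n z y x" "cost P n z y x < \<infinity>"
proof -
  have t': "Suc t \<le> horizon P" "Suc t \<in> {1..horizon P}" using t by auto
  have win: "(x, y, z) \<in> node_feas P (Suc t) n" using fwd_in[OF j t'(2) n] w by simp
  show "0 \<le> cost P n z y x" by (rule cost_nonneg[OF problem t'(1) n win])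
  obtain x' y' z' where w': "(x', y', z') \<in> node_feas P (Suc t) n" "cost P n z' y' x' < \<infinity>"
    by (rule exists_finite_cost[OF problem feasible t'(1) n])
  have j1: "j - 1 \<le> K" using j by auto
  let ?f = "node_obj P n (trial R j t) (lowQ R (j - 1) (Suc t))"
  have low: "0 \<le> lowQ R (j - 1) (Suc t) a \<and> lowQ R (j - 1) (Suc t) a < \<infinity>"
    if "(a, b, c) \<in> node_feas P (Suc t) n" for a b c
    using lowQ_finite[OF j1 t'(1) node_feas_state[OF t'(1) n that]] .
  have "?f (x, y, z) \<le> ?f (x', y', z')"
    using fwd_arg_min[OF j t'(2) n] w w'(1) by (auto simp: is_arg_min_def not_less)
  also have "\<dots> < \<infinity>" using w'(2) low[OF w'(1)] by (simp add: node_obj_def)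
  finally show "cost P n z y x < \<infinity>" using low[OF win] by (auto simp: node_obj_def)
qed

text \<open>In this case \<open>rbound\<close> is 0, so every cut is affine and the approximation is
  a maximum of finitely many affine functions. A real-valued q is produced for use in the separation
  argument.\<close>

lemma lowQ_convex:
  assumes cp: "convex_problem P" "norm_penalties P"
  shows "j \<le> K \<Longrightarrow> t \<le> horizon P \<Longrightarrow>
    \<exists>q. convex_on (state_dom t) q \<and> (\<forall>x\<in>state_dom t. lowQ R j t x = ereal (q x))"
proof (induction j)
  case 0
  have "convex (state_dom t)"
    using stspace_subspace[OF problem, of t] by (simp add: state_dom_def subspace_imp_convex)
  then have "convex_on (state_dom t) (\<lambda>_. 0)" by (simp add: convex_on_const)
  moreover have "\<forall>x\<in>state_dom t. lowQ R 0 t x = ereal 0"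
    using init \<open>t \<le> horizon P\<close> by (cases "t = horizon P") (auto simp: ddp_init_def state_dom_def)
  ultimately show ?case by blast
next
  case (Suc j)
  then obtain q where q: "convex_on (state_dom t) q" "\<forall>x\<in>state_dom t. lowQ R j t x = ereal (q x)"
    by auto
  show ?case
  proof (cases "t = horizon P")
    case True
    then have "\<forall>x\<in>state_dom t. lowQ R (Suc j) t x = ereal (q x)" using q(2) init by (simp add: ddp_init_def)
    then show ?thesis using q(1) by blast
  next
    case False
    then have t: "t < horizon P" using Suc.prems by simp
    have j: "Suc j \<in> {1..K}" using Suc.prems by simp
    have b: "backward_step P R (Suc j) (Suc t)" using iteration(2)[OF j, of "Suc t"] t by simp
    have dom: "state_dom t = stspace P t" using t by (simp add: state_dom_def)
    define l where "l m = fst (mult R (Suc j) m)" for m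
    define c where "c m = real_of_ereal (lowv R (Suc j) m) - l m \<bullet> trial R (Suc j) t" for m
    have cut: "cut P R (Suc j) (Suc t) m x = ereal (l m \<bullet> x + c m)" if m: "m \<in> nodes P (Suc t)" for m x
    proof -
      obtain l' \<rho> where lr: "mult R (Suc j) m = (l', \<rho>)" by (cases "mult R (Suc j) m")
      have "mult R (Suc j) m \<in> dual_set P (Suc t) m"
        using b m by (simp add: backward_step_def is_arg_max_def)
      moreover have "rbound P m = 0" using dual cp t m by (simp add: dual_bounds_def)
      ultimately have "\<rho> = 0" using lr by (simp add: dual_set_def)
      moreover have "lowv R (Suc j) m = ereal (real_of_ereal (lowv R (Suc j) m))"
        using lowv_finite[OF j t m] by (simp add: ereal_real)
      ultimately show ?thesis
        unfolding cut_def lr l_def c_def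
        by (cases "lowv R (Suc j) m") (auto simp: inner_diff_right)
    qed
    define a where "a = (\<Sum>m\<in>nodes P (Suc t). prob P t m *\<^sub>R l m)"
    define b where "b = (\<Sum>m\<in>nodes P (Suc t). prob P t m * c m)"
    have "(\<Sum>m\<in>nodes P (Suc t). ereal (prob P t m) * cut P R (Suc j) (Suc t) m x) = ereal (a \<bullet> x + b)" for x
      by (simp add: cut a_def b_def inner_sum_left sum.distrib algebra_simps)
    then have eq: "\<forall>x\<in>state_dom t. lowQ R (Suc j) t x = ereal (max (q x) (a \<bullet> x + b))"
      using update[OF j t] q(2) by (simp add: update_Q_def dom max_def)
    have "convex_on (state_dom t) (\<lambda>x. max (q x) (a \<bullet> x + b))"
      unfolding convex_on_def
    proof (intro conjI ballI allI impI)
      show "convex (state_dom t)" using q(1) by (simp add: convex_on_def)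
      fix x y and u v :: real
      assume xy: "x \<in> state_dom t" "y \<in> state_dom t" and uv: "0 \<le> u" "0 \<le> v" "u + v = 1"
      have "q (u *\<^sub>R x + v *\<^sub>R y) \<le> u * q x + v * q y" using q(1) xy uv by (simp add: convex_on_def)
      also have "\<dots> \<le> u * max (q x) (a \<bullet> x + b) + v * max (q y) (a \<bullet> y + b)"
        using uv by (intro add_mono mult_left_mono) auto
      finally have 1: "q (u *\<^sub>R x + v *\<^sub>R y) \<le> \<dots>" .
      have "a \<bullet> (u *\<^sub>R x + v *\<^sub>R y) + b = u * (a \<bullet> x) + v * (a \<bullet> y) + (u + v) * b"
        using uv by (simp add: inner_add_right)
      also have "\<dots> = u * (a \<bullet> x + b) + v * (a \<bullet> y + b)" by (simp add: algebra_simps)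
      also have "\<dots> \<le> u * max (q x) (a \<bullet> x + b) + v * max (q y) (a \<bullet> y + b)"
        using uv by (intro add_mono mult_left_mono) auto
      finally show "max (q (u *\<^sub>R x + v *\<^sub>R y)) (a \<bullet> (u *\<^sub>R x + v *\<^sub>R y) + b)
        \<le> u * max (q x) (a \<bullet> x + b) + v * max (q y) (a \<bullet> y + b)" using 1 by simp
    qed
    then show ?thesis using eq by blast
  qed
qed

text \<open>The forward pass minimizes with the old lower approximation, the backward pass with the
  updated one; monotonicity points in the right direction.\<close>

lemma forward_le_lagrangian:
  assumes j: "j \<in> {1..K}" and t: "t < horizon P" and n: "n \<in> nodes P (Suc t)"
    and w: "(x, y, z) \<in> node_feas P (Suc t) n"
  shows "node_obj P n (trial R j t) (lowQ R (j - 1) (Suc t)) (fwd R j n) \<le>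
    cost P n z y x + ereal (sigma P n * penalty P n (trial R j t - z)) + lowQ R j (Suc t) x"
proof -
  have t': "Suc t \<in> {1..horizon P}" using t by simp
  have "node_obj P n (trial R j t) (lowQ R (j - 1) (Suc t)) (fwd R j n) \<le>
      node_obj P n (trial R j t) (lowQ R (j - 1) (Suc t)) (x, y, z)"
    using fwd_arg_min[OF j t' n] w by (auto simp: is_arg_min_def not_less)
  also have "\<dots> \<le> cost P n z y x + ereal (sigma P n * penalty P n (trial R j t - z)) + lowQ R j (Suc t) x"
    unfolding node_obj_def prod.case
    using lowQ_step_mono[OF j _ node_feas_state[OF _ n w]] t by (intro add_left_mono) simp
  finally show ?thesis .
qed

text \<open>It suffices to exhibit one admissible multiplier whose Lagrangian dominates the forward
  value everywhere: (0, \<open>sigma\<close>) if \<open>rbound\<close> permits it, otherwise (l, 0)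
  with l from the separation argument.\<close>

lemma lowv_ge:
  assumes j: "j \<in> {1..K}" and t: "t < horizon P" and n: "n \<in> nodes P (Suc t)"
  shows "node_obj P n (trial R j t) (lowQ R (j - 1) (Suc t)) (fwd R j n) \<le> lowv R j n"
    (is "?v \<le> _")
proof -
  let ?u = "trial R j t" and ?W = "node_feas P (Suc t) n"
  let ?S = "stspace P t" and ?N = "stnorm P t"
  have t': "Suc t \<le> horizon P" "Suc t \<in> {1..horizon P}" using t by auto
  have jK: "j \<le> K" "j - 1 \<le> K" using j by auto
  note le = forward_le_lagrangian[OF j t n]
  have sigma0: "0 < sigma P n" using sigma_pos[OF t'(1) n] .
  have lv: "lowv R j n = (SUP w \<in> dual_set P (Suc t) n. dual_inner P R j (Suc t) n w)"
    using iteration(2)[OF j t'(2)] n by (simp add: backward_step_def)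
  have *: "?v \<le> lowv R j n"
    if "(l, \<rho>) \<in> dual_set P (Suc t) n"
      and "\<And>x y z. (x, y, z) \<in> ?W \<Longrightarrow>
        ?v \<le> cost P n z y x + ereal (l \<bullet> (?u - z)) + ereal (\<rho> * penalty P n (?u - z)) + lowQ R j (Suc t) x"
    for l \<rho>
  proof -
    have "?v \<le> dual_inner P R j (Suc t) n (l, \<rho>)"
      unfolding dual_inner_def prod.case
    proof (rule INF_greatest)
      fix w assume "w \<in> ?W"
      moreover obtain x y z where w: "w = (x, y, z)" by (cases w)
      ultimately show "?v \<le> (case w of (x, y, z) \<Rightarrow> cost P n z y x + ereal (l \<bullet> (trial R j (Suc t - 1) - z))
          + ereal (\<rho> * penalty P n (trial R j (Suc t - 1) - z)) + lowQ R j (Suc t) x)"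
        using that(2)[of x y z] by simp
    qed
    also have "\<dots> \<le> lowv R j n" unfolding lv by (rule SUP_upper[OF that(1)])
    finally show ?thesis .
  qed
  show ?thesis
  proof (cases "convex_problem P \<and> norm_penalties P")
    case False
    then have "sigma P n \<le> rbound P n" using dual t n by (auto simp: dual_bounds_def)
    then have "(0, sigma P n) \<in> dual_set P (Suc t) n"
      using sigma0 by (intro zero_in_dual_set[OF t n]) auto
    then show ?thesis by (rule *) (use le in simp)
  next
    case True
    note N = stspace_norm[OF problem t] and S = stspace_subspace[OF problem t]
    have pen: "penalty P n s = ?N s" if "s \<in> ?S" for s
      using True t n that by (auto simp: norm_penalties_def)
    have lb: "sigma P n \<le> lbound P n" "rbound P n = 0" using True dual t n by (auto simp: dual_bounds_def)
    obtain q where q: "convex_on (state_dom (Suc t)) q" "\<forall>x\<in>state_dom (Suc t). lowQ R j (Suc t) x = ereal (q x)"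
      using lowQ_convex[of j "Suc t"] True jK t' by blast
    have diffS: "?u - z \<in> ?S" if "(x, y, z) \<in> ?W" for x y z
      using trial_in[OF j t] node_feas_prev[OF that] stset_subset[OF problem t]
      by (intro subspace_diff[OF S]) auto
    have cvx: "ereal_convex_on ?W (\<lambda>(x, y, z). cost P n z y x)"
      using True n t' by (simp add: convex_problem_def)
    obtain x0 y0 z0 where f0: "fwd R j n = (x0, y0, z0)" by (cases "fwd R j n")
    have "x0 \<in> state_dom (Suc t)" using fwd_in[OF j t'(2) n] node_feas_state[OF t'(1) n] f0 by simp
    then have "\<bar>?v\<bar> \<noteq> \<infinity>"
      using fwd_cost_finite[OF j t n f0] lowQ_finite[OF jK(2) t'(1), of x0]
      unfolding f0 node_obj_def by auto
    then obtain v where v: "?v = ereal v" by auto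
    \<comment> \<open>Pairs of a deviation \<open>?u - z\<close> and a majorant of cost plus future
      cost: the epigraph of the perturbed problem. It is convex since the feasible set, the cost and
      q are.\<close>
    define A where "A = {(?u - z, a) | x y z a. (x, y, z) \<in> ?W \<and> cost P n z y x + ereal (q x) \<le> ereal a}"
    have "convex A"
      unfolding convex_def
    proof (intro ballI allI impI)
      fix p p' and \<mu> \<nu> :: real
      assume "p \<in> A" "p' \<in> A" and uv: "0 \<le> \<mu>" "0 \<le> \<nu>" "\<mu> + \<nu> = 1"
      then obtain x y z a x' y' z' a' where p: "p = (?u - z, a)" "p' = (?u - z', a')"
        and W: "(x, y, z) \<in> ?W" "(x', y', z') \<in> ?W"
        and c: "cost P n z y x + ereal (q x) \<le> ereal a" "cost P n z' y' x' + ereal (q x') \<le> ereal a'"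
        unfolding A_def by blast
      let ?x = "\<mu> *\<^sub>R x + \<nu> *\<^sub>R x'" and ?y = "\<mu> *\<^sub>R y + \<nu> *\<^sub>R y'" and ?z = "\<mu> *\<^sub>R z + \<nu> *\<^sub>R z'"
      have nn: "0 \<le> cost P n z y x" "0 \<le> cost P n z' y' x'"
        using cost_nonneg[OF problem t'(1) n] W by auto
      obtain k k' where k: "cost P n z y x = ereal k" "cost P n z' y' x' = ereal k'"
        using c nn by (cases "cost P n z y x"; cases "cost P n z' y' x'") auto
      have comb: "\<mu> *\<^sub>R (x, y, z) + \<nu> *\<^sub>R (x', y', z') = (?x, ?y, ?z)" by simp
      have inW: "(?x, ?y, ?z) \<in> ?W"
        using cvx W uv comb unfolding ereal_convex_on_def convex_def by metis
      have "(case \<mu> *\<^sub>R (x, y, z) + \<nu> *\<^sub>R (x', y', z') of (x, y, z) \<Rightarrow> cost P n z y x)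
          \<le> ereal \<mu> * (case (x, y, z) of (x, y, z) \<Rightarrow> cost P n z y x)
            + ereal \<nu> * (case (x', y', z') of (x, y, z) \<Rightarrow> cost P n z y x)"
        using cvx W uv unfolding ereal_convex_on_def by blast
      then have "cost P n ?z ?y ?x \<le> ereal (\<mu> * k + \<nu> * k')" unfolding comb prod.case k by simp
      moreover have "q ?x \<le> \<mu> * q x + \<nu> * q x'"
        using q(1) uv node_feas_state[OF t'(1) n] W unfolding convex_on_def by blast
      ultimately have "cost P n ?z ?y ?x + ereal (q ?x) \<le> ereal (\<mu> * k + \<nu> * k') + ereal (\<mu> * q x + \<nu> * q x')"
        by (intro add_mono) auto
      also have "\<dots> = ereal (\<mu> * (k + q x) + \<nu> * (k' + q x'))" by (simp add: algebra_simps)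
      also have "\<dots> \<le> ereal (\<mu> * a + \<nu> * a')"
        using c k uv by (auto intro!: add_mono mult_left_mono)
      finally have "(?u - ?z, \<mu> * a + \<nu> * a') \<in> A" unfolding A_def using inW by blast
      moreover have "\<mu> *\<^sub>R p + \<nu> *\<^sub>R p' = (?u - ?z, \<mu> * a + \<nu> * a')"
      proof -
        have "\<mu> *\<^sub>R (?u - z) + \<nu> *\<^sub>R (?u - z') = (\<mu> + \<nu>) *\<^sub>R ?u - ?z" by (simp add: algebra_simps)
        then show ?thesis using p uv by simp
      qed
      ultimately show "\<mu> *\<^sub>R p + \<nu> *\<^sub>R p' \<in> A" by simp
    qed
    moreover have "A \<noteq> {}"
    proof -
      obtain x y z where w: "(x, y, z) \<in> ?W" "cost P n z y x < \<infinity>"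
        by (rule exists_finite_cost[OF problem feasible t'(1) n])
      then obtain k where "cost P n z y x = ereal k"
        using cost_nonneg[OF problem t'(1) n w(1)] by (cases "cost P n z y x") auto
      then have "(?u - z, k + q x) \<in> A" unfolding A_def using w(1) by force
      then show ?thesis by blast
    qed
    moreover have "s \<in> ?S \<and> v \<le> a + sigma P n * ?N s" if sa: "(s, a) \<in> A" for s a
    proof -
      obtain x y z where w: "(x, y, z) \<in> ?W" "s = ?u - z" "cost P n z y x + ereal (q x) \<le> ereal a"
        using sa unfolding A_def by blast
      have sS: "s \<in> ?S" using diffS[OF w(1)] w(2) by simp
      have "ereal v \<le> cost P n z y x + ereal (sigma P n * ?N s) + ereal (q x)"
        using le[OF w(1)] q(2) node_feas_state[OF t'(1) n w(1)] pen[OF sS] w(2) v by simp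
      also have "\<dots> = (cost P n z y x + ereal (q x)) + ereal (sigma P n * ?N s)"
        by (simp add: ac_simps)
      also have "\<dots> \<le> ereal a + ereal (sigma P n * ?N s)" using w(3) by (rule add_right_mono)
      finally show ?thesis using sS by simp
    qed
    ultimately obtain l where l: "l \<in> ?S" "\<And>s. s \<in> ?S \<Longrightarrow> l \<bullet> s \<le> sigma P n * ?N s"
        "\<And>s a. (s, a) \<in> A \<Longrightarrow> v \<le> a + l \<bullet> s"
      using norm_penalty_multiplier[OF N S less_imp_le[OF sigma0], of A v] by metis
    have "dual_norm_on ?S ?N l \<le> sigma P n" using dual_norm_on_le[OF N S _ l(2)] sigma0 by simp
    then have "(l, 0) \<in> dual_set P (Suc t) n" using l(1) lb by (simp add: dual_set_def)
    then show ?thesis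
    proof (rule *)
      fix x y z assume w: "(x, y, z) \<in> ?W"
      show "?v \<le> cost P n z y x + ereal (l \<bullet> (?u - z)) + ereal (0 * penalty P n (?u - z)) + lowQ R j (Suc t) x"
      \<comment> \<open>A contains only points of finite cost; where the cost is infinite the
        inequality is trivial.\<close>
      proof (cases "cost P n z y x")
        case (real k)
        then have "(?u - z, k + q x) \<in> A" unfolding A_def using w by force
        from l(3)[OF this] show ?thesis using real q(2) node_feas_state[OF t'(1) n w] v by simp
      next
        case PInf
        then show ?thesis using q(2) node_feas_state[OF t'(1) n w] by simp
      next
        case MInf
        then show ?thesis using cost_nonneg[OF problem t'(1) n w] by simp
      qed
    qed
  qed
qed

section \<open>Transfer of gaps from stage t + 1 to stage t\<close>

lemma upv_le:
  assumes j: "j \<in> {1..K}" and t: "t < horizon P" and n: "n \<in> nodes P (Suc t)"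
    and g: "gap R j (Suc t) n \<le> ereal \<delta>"
  shows "upv R j n \<le> lowv R j n + ereal \<delta>"
proof -
  have t': "Suc t \<le> horizon P" "Suc t \<in> {1..horizon P}" using t by auto
  have j1: "j - 1 \<le> K" using j by auto
  obtain x y z where f: "fwd R j n = (x, y, z)" by (cases "fwd R j n")
  have x: "x \<in> state_dom (Suc t)" using fwd_in[OF j t'(2) n] node_feas_state[OF t'(1) n] f by simp
  have "upQ R (j - 1) (Suc t) x \<le> lowQ R (j - 1) (Suc t) x + ereal \<delta>"
    using g lowQ_finite[OF j1 t'(1) x] unfolding gap_def f fst_conv
    by (cases "lowQ R (j - 1) (Suc t) x"; cases "upQ R (j - 1) (Suc t) x") auto
  then have up: "upQ R j (Suc t) x \<le> lowQ R (j - 1) (Suc t) x + ereal \<delta>"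
    using upQ_step_mono[OF j t'(1) x] by (rule order_trans[rotated])
  have "upv R j n = node_obj P n (trial R j t) (upQ R j (Suc t)) (x, y, z)"
    using iteration(2)[OF j t'(2)] n f by (simp add: backward_step_def)
  \<comment> \<open>The forward solution is kept and only its future cost is exchanged, at the price
    of the gap at its state.\<close>
  also have "\<dots> \<le> node_obj P n (trial R j t) (lowQ R (j - 1) (Suc t)) (x, y, z) + ereal \<delta>"
    unfolding node_obj_def prod.case add.assoc using up by (intro add_left_mono) (simp add: add.assoc)
  also have "\<dots> \<le> lowv R j n + ereal \<delta>" using lowv_ge[OF j t n] f by (intro add_right_mono) simp
  finally show ?thesis .
qed

text \<open>At the trial point the cut has the value \<open>lowv\<close>. Moving to x loses at most
  \<open>lbound\<close> times the distance through the linear part and \<open>rbound\<close> times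
  the distance through the penalty, which is 1-Lipschitz on differences of states.\<close>

lemma cut_ge:
  assumes j: "j \<in> {1..K}" and t: "t < horizon P" and n: "n \<in> nodes P (Suc t)"
    and x: "x \<in> stset P t"
  shows "lowv R j n \<le> cut P R j (Suc t) n x
    + ereal ((lbound P n + rbound P n) * stnorm P t (x - trial R j t))"
proof -
  let ?u = "trial R j t"
  note N = stspace_norm[OF problem t] and S = stspace_subspace[OF problem t]
  have t': "Suc t \<in> {1..horizon P}" using t by auto
  have u: "?u \<in> stset P t" using trial_in[OF j t] .
  have uxS: "?u \<in> stspace P t" "x \<in> stspace P t" using u x stset_subset[OF problem t] by auto
  have N0: "0 \<le> stnorm P t (?u - x)" using N subspace_diff[OF S uxS] by (simp add: norm_on_def)
  obtain l \<rho> where lr: "mult R j n = (l, \<rho>)" by (cases "mult R j n")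
  have "mult R j n \<in> dual_set P (Suc t) n"
    using iteration(2)[OF j t'] n by (simp add: backward_step_def is_arg_max_def)
  then have l: "dual_norm_on (stspace P t) (stnorm P t) l \<le> lbound P n" "0 \<le> \<rho>" "\<rho> \<le> rbound P n"
    using lr by (simp_all add: dual_set_def)
  have "l \<bullet> (?u - x) \<le> dual_norm_on (stspace P t) (stnorm P t) l * stnorm P t (?u - x)"
    by (rule inner_le_dual_norm_on[OF N S subspace_diff[OF S uxS]])
  also have "\<dots> \<le> lbound P n * stnorm P t (?u - x)" using l(1) N0 by (rule mult_right_mono)
  finally have 1: "l \<bullet> (?u - x) \<le> lbound P n * stnorm P t (?u - x)" .
  have "\<rho> * penalty P n (?u - x) \<le> \<rho> * stnorm P t (?u - x)"
    using penalty_le_norm[OF t n u x] l(2) by (rule mult_left_mono)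
  also have "\<dots> \<le> rbound P n * stnorm P t (?u - x)" using l(3) N0 by (rule mult_right_mono)
  finally have 2: "\<rho> * penalty P n (?u - x) \<le> rbound P n * stnorm P t (?u - x)" .
  have "stnorm P t (?u - x) = stnorm P t (x - ?u)" by (rule norm_on_commute[OF N S uxS])
  with 1 2 have "0 \<le> - (l \<bullet> (?u - x)) - \<rho> * penalty P n (?u - x)
      + (lbound P n + rbound P n) * stnorm P t (x - ?u)" by (simp add: algebra_simps)
  then show ?thesis
    unfolding cut_def lr prod.case by (cases "lowv R j n") (auto simp: algebra_simps)
qed

text \<open>The upper approximation lies below the cone and the lower one above the averaged cuts.
  Each contributes a slope of at most \<open>lip_const P t\<close>, and the values at the trial
  point differ by at most \<delta> at each node.\<close>

lemma gap_near_trial: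
  assumes j: "j \<in> {1..K}" and t: "t < horizon P" and x: "x \<in> stset P t"
    and g: "\<And>n. n \<in> nodes P (Suc t) \<Longrightarrow> gap R j (Suc t) n \<le> ereal \<delta>"
  shows "upQ R j t x - lowQ R j t x \<le> ereal (\<delta> + 2 * lip_const P t * stnorm P t (x - trial R j t))"
proof -
  let ?r = "stnorm P t (x - trial R j t)" and ?M = "nodes P (Suc t)"
  have xS: "x \<in> stspace P t" using x stset_subset[OF problem t] by blast
  have uS: "trial R j t \<in> stspace P t" using trial_in[OF j t] stset_subset[OF problem t] by blast
  have r0: "0 \<le> ?r"
    using stspace_norm[OF problem t] subspace_diff[OF stspace_subspace[OF problem t] xS uS]
    by (simp add: norm_on_def)
  define c where "c m = real_of_ereal (cut P R j (Suc t) m x)" for m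
  have c: "cut P R j (Suc t) m x = ereal (c m)" if "m \<in> ?M" for m
    using lowv_finite[OF j t that] unfolding c_def cut_def
    by (cases "mult R j m"; cases "lowv R j m") auto
  have "upper_cone P R j t x \<le> (\<Sum>m\<in>?M. ereal (prob P t m * (c m + \<delta> + 2 * (lbound P m + rbound P m) * ?r)))"
    unfolding upper_cone_def
  proof (rule sum_mono)
    fix m assume m: "m \<in> ?M"
    have "upv R j m \<le> lowv R j m + ereal \<delta>" by (rule upv_le[OF j t m g[OF m]])
    also have "\<dots> \<le> ereal (c m) + ereal ((lbound P m + rbound P m) * ?r) + ereal \<delta>"
      using cut_ge[OF j t m x] c[OF m] by (intro add_right_mono) simp
    finally have "upv R j m + ereal (sigma P m * ?r) \<le>
        ereal (c m) + ereal ((lbound P m + rbound P m) * ?r) + ereal \<delta> + ereal (sigma P m * ?r)"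
      by (rule add_right_mono)
    also have "\<dots> \<le> ereal (c m + \<delta> + 2 * (lbound P m + rbound P m) * ?r)"
      using mult_right_mono[OF bounds_nonneg(3)[OF t m] r0] by (simp add: algebra_simps)
    finally have "ereal (prob P t m) * (upv R j m + ereal (sigma P m * ?r)) \<le>
        ereal (prob P t m) * ereal (c m + \<delta> + 2 * (lbound P m + rbound P m) * ?r)"
      using prob_pos[OF problem t m] by (intro ereal_mult_left_mono) auto
    then show "ereal (prob P t m) * (upv R j m + ereal (sigma P m * ?r)) \<le>
        ereal (prob P t m * (c m + \<delta> + 2 * (lbound P m + rbound P m) * ?r))" by simp
  qed
  also have "\<dots> = ereal ((\<Sum>m\<in>?M. prob P t m * c m) + (\<delta> + 2 * lip_const P t * ?r))"
  proof -
    have "(\<Sum>m\<in>?M. prob P t m * (c m + \<delta> + 2 * (lbound P m + rbound P m) * ?r))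
        = (\<Sum>m\<in>?M. prob P t m * c m) + (\<Sum>m\<in>?M. prob P t m) * \<delta>
          + 2 * (\<Sum>m\<in>?M. prob P t m * (lbound P m + rbound P m)) * ?r"
      unfolding sum_distrib_right sum_distrib_left sum.distrib[symmetric]
      by (intro sum.cong) (simp_all add: algebra_simps)
    then show ?thesis by (simp add: prob_sum[OF problem t] lip_const_def)
  qed
  finally have up: "upQ R j t x \<le> ereal ((\<Sum>m\<in>?M. prob P t m * c m) + (\<delta> + 2 * lip_const P t * ?r))"
    using upQ_step(2)[OF j t xS] by simp
  have "ereal (\<Sum>m\<in>?M. prob P t m * c m) \<le> lowQ R j t x"
    using update[OF j t] xS c by (simp add: update_Q_def)
  with up have "upQ R j t x - lowQ R j t x \<le> ereal ((\<Sum>m\<in>?M. prob P t m * c m)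
      + (\<delta> + 2 * lip_const P t * ?r)) - ereal (\<Sum>m\<in>?M. prob P t m * c m)"
    by (rule ereal_minus_mono)
  then show ?thesis by simp
qed

text \<open>UB is at most, and LB equal to, the root objective with upper and lower future cost at
  the same trial point, so the finite root cost cancels.\<close>

lemma root_gap:
  assumes j: "j \<in> {1..K}"
  shows "ereal \<eta> < upQ R (j - 1) 0 (trial R j 0) - lowQ R (j - 1) 0 (trial R j 0)"
proof -
  let ?w = "(trial R j 0, trial_y R j)" and ?x = "trial R j 0"
  let ?c = "cost P (root_node P) 0 (trial_y R j) (trial R j 0)"
  have T0: "0 < horizon P" using horizon_pos[OF problem] by simp
  have r: "root_node P \<in> nodes P 0" using root_nodes[OF problem] by simp
  have nf: "(x, y, z) \<in> node_feas P 0 (root_node P) \<longleftrightarrow> (x, y) \<in> feas P (root_node P) \<and> z = 0" for x y z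
    by (simp add: node_feas_def prev_set_def)
  have jK: "j - 1 \<le> K" using j by auto
  have dom: "x \<in> state_dom 0" if "(x, y) \<in> feas P (root_node P)" for x y
    using node_feas_state[OF _ r, of x y 0] nf that by simp
  have w: "?w \<in> feas P (root_node P)" using root_trial[OF j] by (simp add: is_arg_min_def)
  have c0: "0 \<le> ?c" using cost_nonneg[OF problem _ r] nf w by simp
  have low: "0 \<le> lowQ R (j - 1) 0 x \<and> lowQ R (j - 1) 0 x < \<infinity>" if "(x, y) \<in> feas P (root_node P)" for x y
    using lowQ_finite[OF jK _ dom[OF that]] by simp
  have Q0: "lowQ R 0 0 x = 0" "upQ R 0 0 x = \<infinity>" if "(x, y) \<in> feas P (root_node P)" for x y
    using init T0 dom[OF that] by (auto simp: ddp_init_def state_dom_def)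
  \<comment> \<open>For j = 1 the minimized objective has zero future cost, which agrees with
    \<open>lowQ R 0 0\<close> at all feasible states.\<close>
  have am: "root_obj P (lowQ R (j - 1) 0) ?w \<le> root_obj P (lowQ R (j - 1) 0) (x, y)"
    if "(x, y) \<in> feas P (root_node P)" for x y
    using root_trial[OF j] that w Q0(1)[OF that] Q0(1)[OF w]
    by (cases "j = 1") (auto simp: is_arg_min_def not_less root_obj_def)
  obtain x' y' z' where w': "(x', y', z') \<in> node_feas P 0 (root_node P)" "cost P (root_node P) z' y' x' < \<infinity>"
    by (rule exists_finite_cost[OF problem feasible _ r]) simp_all
  then have "root_obj P (lowQ R (j - 1) 0) (x', y') < \<infinity>"
    using nf low by (auto simp: root_obj_def)
  then have "root_obj P (lowQ R (j - 1) 0) ?w < \<infinity>" using am[of x' y'] w'(1) nf by (meson order_le_less_trans)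
  then have cfin: "?c < \<infinity>" using low[OF w] by (auto simp: root_obj_def)
  have lb: "lb R (j - 1) = ?c + lowQ R (j - 1) 0 ?x"
  proof (cases "j = 1")
    case True
    then show ?thesis using init Q0(1)[OF w] by (simp add: ddp_init_def root_obj_def)
  next
    case False
    then have j': "j - 1 \<in> {1..K}" "j - 1 + 1 = j" using j by auto
    show ?thesis using iteration(3)[OF j'(1)] j'(2) by (simp add: root_step_def Let_def root_obj_def)
  qed
  have ub: "ub R (j - 1) \<le> ?c + upQ R (j - 1) 0 ?x"
  proof (cases "j = 1")
    case True
    then show ?thesis using Q0(2)[OF w] c0 by simp
  next
    case False
    then have j': "j - 1 \<in> {1..K}" "j - 1 + 1 = j" using j by auto
    show ?thesis using iteration(3)[OF j'(1)] j'(2)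
      by (auto simp: root_step_def Let_def root_obj_def not_less split: if_splits)
  qed
  have "ereal \<eta> < ub R (j - 1) - lb R (j - 1)" by (rule iteration(4)[OF j])
  also have "\<dots> \<le> (?c + upQ R (j - 1) 0 ?x) - (?c + lowQ R (j - 1) 0 ?x)"
    using ub lb by (intro ereal_minus_mono) auto
  also have "\<dots> = upQ R (j - 1) 0 ?x - lowQ R (j - 1) 0 ?x"
    using c0 cfin low[OF w]
    by (cases ?c; cases "lowQ R (j - 1) 0 ?x"; cases "upQ R (j - 1) 0 ?x") auto
  finally show ?thesis .
qed

section \<open>Assignment of iterations to stages and their count\<close>

definition trial_gap :: "nat \<Rightarrow> nat \<Rightarrow> ereal" where
  "trial_gap j t = upQ R (j - 1) t (trial R j t) - lowQ R (j - 1) t (trial R j t)"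

lemma trial_gap_horizon: "trial_gap j (horizon P) = 0"
  using init by (simp add: trial_gap_def ddp_init_def)

text \<open>Here the node selection enters: the trial point is a state of largest gap. At stage T
  nothing is selected, but all gaps are 0.\<close>

lemma gap_le_trial_gap:
  assumes j: "j \<in> {1..K}" and t: "t < horizon P" and n: "n \<in> nodes P (Suc t)"
  shows "gap R j (Suc t) n \<le> trial_gap j (Suc t)"
proof (cases "Suc t = horizon P")
  case True
  then show ?thesis using trial_gap_horizon[of j] init unfolding True
    by (simp add: gap_def ddp_init_def)
next
  case False
  then have t': "Suc t < horizon P" "Suc t \<in> {1..horizon P}" using t by auto
  have "forward_step P R j (Suc t)" by (rule iteration(1)[OF j t'(2)])
  then obtain k where "\<forall>n\<in>nodes P (Suc t). gap R j (Suc t) n \<le> gap R j (Suc t) k"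
      "trial R j (Suc t) = fst (fwd R j k)"
    using t'(1) unfolding forward_step_def by blast
  then have "gap R j (Suc t) n \<le> gap R j (Suc t) k" "trial R j (Suc t) = fst (fwd R j k)"
    using n by auto
  then show ?thesis by (simp add: gap_def trial_gap_def)
qed

definition stage_iterations :: "real \<Rightarrow> nat \<Rightarrow> nat set" where
  "stage_iterations \<epsilon> t = {j \<in> {1..K}. ereal (real (horizon P - t) * \<epsilon>) < trial_gap j t \<and>
     trial_gap j (Suc t) \<le> ereal (real (horizon P - Suc t) * \<epsilon>)}"

lemma trial_separation:
  assumes t: "t < horizon P" and \<epsilon>: "0 < \<epsilon>"
    and i: "i \<in> stage_iterations \<epsilon> t" and j: "j \<in> stage_iterations \<epsilon> t" and ij: "i < j"
  shows "\<epsilon> / (2 * lip_const P t) \<le> stnorm P t (trial R j t - trial R i t)"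
proof -
  let ?x = "trial R j t" and ?\<delta> = "real (horizon P - Suc t) * \<epsilon>"
  let ?r = "stnorm P t (?x - trial R i t)"
  have iK: "i \<in> {1..K}" and jK: "j \<in> {1..K}" using i j by (simp_all add: stage_iterations_def)
  have x: "?x \<in> stset P t" by (rule trial_in[OF jK t])
  then have xd: "?x \<in> state_dom t" using stset_subset[OF problem t] t by (auto simp: state_dom_def)
  have small: "trial_gap i (Suc t) \<le> ereal ?\<delta>" using i by (simp add: stage_iterations_def)
  have "ereal (real (horizon P - t) * \<epsilon>) < trial_gap j t" using j by (simp add: stage_iterations_def)
  \<comment> \<open>As i < j means i <= j - 1, the approximations in \<open>trial_gap j\<close>
    already contain the update of iteration i.\<close>
  also have "\<dots> \<le> upQ R i t ?x - lowQ R i t ?x"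
    unfolding trial_gap_def using ij jK t xd by (intro gap_mono) auto
  also have "\<dots> \<le> ereal (?\<delta> + 2 * lip_const P t * ?r)"
    using gap_le_trial_gap[OF iK t] small by (intro gap_near_trial[OF iK t x]) (rule order_trans)
  finally have "real (horizon P - t) * \<epsilon> < ?\<delta> + 2 * lip_const P t * ?r" by simp
  \<comment> \<open>The thresholds of consecutive stages differ by \<epsilon>, which the term with
    the distance has to make up for.\<close>
  moreover have "real (horizon P - t) * \<epsilon> = ?\<delta> + \<epsilon>"
    using t by (simp add: of_nat_diff algebra_simps)
  ultimately have "\<epsilon> < 2 * lip_const P t * ?r" by simp
  then show ?thesis using lip_const_pos[OF t] by (simp add: field_simps)
qed

lemma card_stage_iterations:
  assumes t: "t < horizon P" and \<epsilon>: "0 < \<epsilon>"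
  shows "real (card (stage_iterations \<epsilon> t)) \<le>
    (1 + 2 * lip_const P t * state_diameter P t / \<epsilon>) ^ dim (stspace P t)"
proof -
  have "real (card (stage_iterations \<epsilon> t)) \<le>
      (1 + state_diameter P t / (\<epsilon> / (2 * lip_const P t))) ^ dim (stspace P t)"
  proof (rule card_separated_states_le[OF problem t, where f = "\<lambda>j. trial R j t"])
    show "finite (stage_iterations \<epsilon> t)" by (simp add: stage_iterations_def)
    show "(\<lambda>j. trial R j t) ` stage_iterations \<epsilon> t \<subseteq> stset P t"
      using trial_in t by (auto simp: stage_iterations_def)
    show "0 < \<epsilon> / (2 * lip_const P t)" using \<epsilon> lip_const_pos[OF t] by simp
  qed (rule trial_separation[OF t \<epsilon>])
  then show ?thesis using \<epsilon> by (simp add: mult_ac)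
qed

lemma iterations_covered:
  assumes \<epsilon>: "\<eta> = real (horizon P) * \<epsilon>"
  shows "{1..K} \<subseteq> (\<Union>t<horizon P. stage_iterations \<epsilon> t)"
proof
  fix j assume j: "j \<in> {1..K}"
  let ?small = "\<lambda>t. trial_gap j t \<le> ereal (real (horizon P - t) * \<epsilon>)"
  have "?small (horizon P)" by (simp add: trial_gap_horizon)
  moreover have "\<not> ?small 0" using root_gap[OF j] \<epsilon> by (simp add: trial_gap_def not_le)
  \<comment> \<open>Small at stage T and not small at the root, so some stage is the last one before
    the first small gap.\<close>
  ultimately obtain t where "t < horizon P" "\<not> ?small t" "?small (Suc t)"
    using ex_least_nat_less[of ?small "horizon P"] by blast
  then show "j \<in> (\<Union>t<horizon P. stage_iterations \<epsilon> t)"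
    using j by (auto simp: stage_iterations_def not_le)
qed

end

theorem corollary2:
  fixes P :: "('n, 'x::euclidean_space, 'y::euclidean_space) msp"
    and R :: "('n, 'x, 'y) ddp_run"
    and L D \<epsilon> :: real and d i :: nat
  assumes "stagewise_problem P"
    and "finite_feasible P"
    and "regularization P"
    and "exact_regularization P"
    and "dual_bounds P"
    and "\<And>t. t < horizon P \<Longrightarrow> lip_const P t \<le> L"
    and "\<And>t. t < horizon P \<Longrightarrow> dim (stspace P t) \<le> d"
    and "\<And>t. t < horizon P \<Longrightarrow> state_diameter P t \<le> D"
    and "0 < \<epsilon>"
    and "ddp_terminates_at P (real (horizon P) * \<epsilon>) R i"
    and "eta_optimal_root P (real (horizon P) * \<epsilon>) (best R i)"
  shows "real i \<le> real (horizon P) * (1 + 2 * L * D / \<epsilon>) ^ d"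
proof -
  interpret ddp_run_setting P R "real (horizon P) * \<epsilon>" i
    using assms by unfold_locales
  let ?I = "stage_iterations \<epsilon>" and ?T = "horizon P"
  have stage: "real (card (?I t)) \<le> (1 + 2 * L * D / \<epsilon>) ^ d" if t: "t < ?T" for t
  proof -
    have L: "0 < lip_const P t" "0 \<le> state_diameter P t"
      using lip_const_pos[OF t] state_diameter_nonneg[OF problem t] by auto
    have LD: "lip_const P t * state_diameter P t \<le> L * D"
      using L assms(6,8)[OF t] by (intro mult_mono) auto
    have "real (card (?I t)) \<le> (1 + 2 * lip_const P t * state_diameter P t / \<epsilon>) ^ dim (stspace P t)"
      by (rule card_stage_iterations[OF t \<open>0 < \<epsilon>\<close>])
    also have "\<dots> \<le> (1 + 2 * L * D / \<epsilon>) ^ dim (stspace P t)"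
      using L LD \<open>0 < \<epsilon>\<close> by (intro power_mono) (simp_all add: divide_right_mono)
    also have "\<dots> \<le> (1 + 2 * L * D / \<epsilon>) ^ d"
    \<comment> \<open>Raising the exponent to d requires a base of at least 1, hence a nonnegative
      \<open>L * D\<close>.\<close>
    proof (rule power_increasing[OF assms(7)[OF t]])
      have "0 \<le> L * D" using LD L by (meson less_imp_le mult_nonneg_nonneg order_trans)
      then show "1 \<le> 1 + 2 * L * D / \<epsilon>" using \<open>0 < \<epsilon>\<close> by (simp add: mult.assoc)
    qed
    finally show ?thesis .
  qed
  have fin: "finite (?I t)" for t by (simp add: stage_iterations_def)
  have "i = card {1..i}" by simp
  also have "\<dots> \<le> card (\<Union>t<?T. ?I t)" using iterations_covered[of \<epsilon>] fin by (intro card_mono) auto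
  also have "\<dots> \<le> (\<Sum>t<?T. card (?I t))" by (rule card_UN_le) simp
  finally have "real i \<le> (\<Sum>t<?T. real (card (?I t)))" by (simp flip: of_nat_sum)
  also have "\<dots> \<le> (\<Sum>t<?T. (1 + 2 * L * D / \<epsilon>) ^ d)" using stage by (intro sum_mono) auto
  finally show ?thesis by simp
qed

end
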